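(* Let $X$ be a complex Banach space with Schauder basis $\{e_n\}_{n\in\mathbb{N}}$ and let $Y$ be any complex Banach space. Then the mapping $\Phi:\mathcal{H}L_0(B_X,Y)\to\mathcal{H}^\infty_s(B_X,\mathcal{L}(X,Y))$ given by $\Phi(f)=df$ is an isometric isomorphism, where $$\mathcal{H}^\infty_s(B_X,\mathcal{L}(X,Y))=\{g\in\mathcal{H}^\infty(B_X,\mathcal{L}(X,Y)) : e_k\circ d(e_n\circ g)=e_n\circ d(e_k\circ g)\ \text{ for all } n,k\in\mathbb{N}\},$$ endowed with the norm inherited from $\mathcal{H}^\infty(B_X,\mathcal{L}(X,Y))$.
   Context: $B_X$ is the open unit ball of $X$ and $\mathcal{L}(X,Y)$ is the Banach space of continuous linear maps from $X$ to $Y$ with the operator norm. For a complex Banach space $Z$, a map $f:B_X\to Z$ is holomorphic if it is (complex) Fréchet differentiable at every point of $B_X$; its differential at $x$ is the continuous complex-linear map $df(x):X\to Z$. $\mathcal{H}^\infty(B_X,Z)$ is the Banach space of bounded holomorphic maps $f:B_X\to Z$ with norm $\|f\|=\sup_{x\in B_X}\|f(x)\|$. $\mathcal{H}L_0(B_X,Y)$ is the Banach space of all $f\in\mathcal{H}^\infty(B_X,Y)$ which are Lipschitz and satisfy $f(0)=0$, with norm $L(f)=\sup\{\|f(x)-f(y)\|/\|x-y\| : x\ne y\in B_X\}$. For a map $g:B_X\to\mathcal{L}(X,Y)$ and $x\in X$, $x\circ g:B_X\to Y$ denotes the function $u\mapsto g(u)(x)$. In particular, for holomorphic $g$ and $x,y\in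 X$, $y\circ d(x\circ g)$ is the function $u\mapsto d(x\circ g)(u)(y)$. An isometric isomorphism is a surjective linear isometry. *)

theory Defs
  imports "HOL-Analysis.Analysis"
begin

section \<open>Complex Banach spaces\<close>

class scaleC =
  fixes scaleC :: "complex \<Rightarrow> 'a \<Rightarrow> 'a" (infixr "*\<^sub>C" 75)

text \<open>The real scalar multiplication, on which the library's topology, derivative and
  bounded linear maps rest, is the restriction of the complex one.\<close>

class complex_normed_vector = real_normed_vector + scaleC +
  assumes scaleC_add_right: "a *\<^sub>C (x + y) = a *\<^sub>C x + a *\<^sub>C y"
    and scaleC_add_left: "(a + b) *\<^sub>C x = a *\<^sub>C x + b *\<^sub>C x"
    and scaleC_scaleC: "a *\<^sub>C (b *\<^sub>C x) = (a * b) *\<^sub>C x"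
    and scaleR_scaleC: "r *\<^sub>R x = complex_of_real r *\<^sub>C x"
    and norm_scaleC: "norm (a *\<^sub>C x) = cmod a * norm x"

class complex_banach = complex_normed_vector + complete_space

subclass (in complex_banach) banach ..

instantiation complex :: complex_banach
begin
definition scaleC_complex_def: "a *\<^sub>C (x::complex) = a * x"
instance
  by standard (simp_all add: scaleC_complex_def algebra_simps norm_mult scaleR_conv_of_real)
end

lemma scaleC_zero_right [simp]: "a *\<^sub>C (0::'a::complex_normed_vector) = 0"
  using norm_scaleC[of a "0::'a"] by simp

lemma scaleC_one [simp]: "1 *\<^sub>C (x::'a::complex_normed_vector) = x"
  using scaleR_scaleC[of 1 x] by simp

lemma scaleC_minus_one [simp]: "(-1) *\<^sub>C (x::'a::complex_normed_vector) = - x"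
  using scaleR_scaleC[of "-1" x] by simp

lemma bounded_linear_scaleC: "bounded_linear (\<lambda>x::'a::complex_normed_vector. a *\<^sub>C x)"
  by (rule bounded_linear_intro[where K = "cmod a"])
     (simp_all add: scaleC_add_right scaleR_scaleC scaleC_scaleC mult.commute norm_scaleC)

definition schauder_basis :: "(nat \<Rightarrow> 'a::complex_normed_vector) \<Rightarrow> bool" where
  "schauder_basis e \<longleftrightarrow> (\<forall>x. \<exists>!a :: nat \<Rightarrow> complex. (\<lambda>n. a n *\<^sub>C e n) sums x)"


section \<open>Continuous complex-linear maps with the operator norm\<close>

typedef (overloaded) ('a, 'b) cblinfun (\<open>(_ \<Rightarrow>\<^sub>C\<^sub>L /_)\<close> [22, 21] 21) =
  "{f :: 'a::complex_normed_vector \<Rightarrow> 'b::complex_normed_vector.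
     bounded_linear f \<and> (\<forall>c x. f (c *\<^sub>C x) = c *\<^sub>C f x)}"
  morphisms cblinfun_apply CBlinfun
  by (intro exI[of _ "\<lambda>_. 0"]) simp

setup_lifting type_definition_cblinfun

lemma bounded_linear_cblinfun_apply: "bounded_linear (cblinfun_apply T)"
  using cblinfun_apply[of T] by simp

lemma cblinfun_apply_scaleC: "cblinfun_apply T (c *\<^sub>C x) = c *\<^sub>C cblinfun_apply T x"
  using cblinfun_apply[of T] by simp

lemma onorm_scaleC:
  fixes f :: "'a::real_normed_vector \<Rightarrow> 'b::complex_normed_vector"
  assumes "bounded_linear f"
  shows "onorm (\<lambda>x. c *\<^sub>C f x) = cmod c * onorm f"
proof -
  have le: "onorm (\<lambda>x. a *\<^sub>C g x) \<le> cmod a * onorm g"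
    if "bounded_linear g" for a :: complex and g :: "'a \<Rightarrow> 'b"
  proof (rule onorm_bound)
    show "0 \<le> cmod a * onorm g"
      using onorm_pos_le[OF that] by simp
    show "norm (a *\<^sub>C g x) \<le> cmod a * onorm g * norm x" for x
      using onorm[OF that, of x] by (simp add: norm_scaleC mult.assoc mult_left_mono)
  qed
  show ?thesis
  proof (cases "c = 0")
    case True
    have "norm ((0::complex) *\<^sub>C f x) = 0" for x
      by (simp only: norm_scaleC) simp
    then show ?thesis
      using True by (simp add: onorm_zero)
  next
    case False
    have "onorm f = onorm (\<lambda>x. inverse c *\<^sub>C (c *\<^sub>C f x))"
      using False by (simp add: scaleC_scaleC)
    also have "\<dots> \<le> cmod (inverse c) * onorm (\<lambda>x. c *\<^sub>C f x)"
      by (rule le) (rule bounded_linear_compose[OF bounded_linear_scaleC assms])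
    finally have "cmod c * onorm f \<le> cmod c * (cmod (inverse c) * onorm (\<lambda>x. c *\<^sub>C f x))"
      by (rule mult_left_mono) simp
    also have "\<dots> = (cmod c * cmod (inverse c)) * onorm (\<lambda>x. c *\<^sub>C f x)"
      by (rule mult.assoc[symmetric])
    also have "cmod c * cmod (inverse c) = 1"
      using False by (simp flip: norm_mult)
    finally have "cmod c * onorm f \<le> onorm (\<lambda>x. c *\<^sub>C f x)" by simp
    with le[OF assms, of c] show ?thesis by simp
  qed
qed

instantiation cblinfun :: (complex_normed_vector, complex_normed_vector) complex_normed_vector
begin

lift_definition norm_cblinfun :: "'a \<Rightarrow>\<^sub>C\<^sub>L 'b \<Rightarrow> real" is onorm .

lift_definition zero_cblinfun :: "'a \<Rightarrow>\<^sub>C\<^sub>L 'b" is "\<lambda>_. 0" by simp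

lift_definition plus_cblinfun :: "'a \<Rightarrow>\<^sub>C\<^sub>L 'b \<Rightarrow> 'a \<Rightarrow>\<^sub>C\<^sub>L 'b \<Rightarrow> 'a \<Rightarrow>\<^sub>C\<^sub>L 'b"
  is "\<lambda>f g x. f x + g x"
  by (simp add: bounded_linear_add scaleC_add_right)

lift_definition scaleC_cblinfun :: "complex \<Rightarrow> 'a \<Rightarrow>\<^sub>C\<^sub>L 'b \<Rightarrow> 'a \<Rightarrow>\<^sub>C\<^sub>L 'b"
  is "\<lambda>c f x. c *\<^sub>C f x"
  by (auto simp: bounded_linear_compose[OF bounded_linear_scaleC] scaleC_scaleC mult.commute)

definition scaleR_cblinfun :: "real \<Rightarrow> 'a \<Rightarrow>\<^sub>C\<^sub>L 'b \<Rightarrow> 'a \<Rightarrow>\<^sub>C\<^sub>L 'b" where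
  "scaleR_cblinfun r T = complex_of_real r *\<^sub>C T"

definition uminus_cblinfun :: "'a \<Rightarrow>\<^sub>C\<^sub>L 'b \<Rightarrow> 'a \<Rightarrow>\<^sub>C\<^sub>L 'b" where
  "uminus_cblinfun T = (-1) *\<^sub>C T"

definition minus_cblinfun :: "'a \<Rightarrow>\<^sub>C\<^sub>L 'b \<Rightarrow> 'a \<Rightarrow>\<^sub>C\<^sub>L 'b \<Rightarrow> 'a \<Rightarrow>\<^sub>C\<^sub>L 'b" where
  "minus_cblinfun S T = S + - T"

definition dist_cblinfun :: "'a \<Rightarrow>\<^sub>C\<^sub>L 'b \<Rightarrow> 'a \<Rightarrow>\<^sub>C\<^sub>L 'b \<Rightarrow> real" where
  "dist_cblinfun S T = norm (S - T)"

definition sgn_cblinfun :: "'a \<Rightarrow>\<^sub>C\<^sub>L 'b \<Rightarrow> 'a \<Rightarrow>\<^sub>C\<^sub>L 'b" where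
  "sgn_cblinfun T = inverse (norm T) *\<^sub>R T"

definition [code del]:
  "(uniformity :: (('a \<Rightarrow>\<^sub>C\<^sub>L 'b) \<times> ('a \<Rightarrow>\<^sub>C\<^sub>L 'b)) filter) =
    (INF e\<in>{0 <..}. principal {(x, y). dist x y < e})"

definition open_cblinfun :: "('a \<Rightarrow>\<^sub>C\<^sub>L 'b) set \<Rightarrow> bool" where [code del]:
  "open_cblinfun U = (\<forall>x\<in>U. \<forall>\<^sub>F (x', y) in uniformity. x' = x \<longrightarrow> y \<in> U)"

instance
proof
  fix S T U :: "'a \<Rightarrow>\<^sub>C\<^sub>L 'b" and a b :: complex and r s :: real and V :: "('a \<Rightarrow>\<^sub>C\<^sub>L 'b) set"
  show "S + T + U = S + (T + U)" by transfer (simp add: add.assoc)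
  show "S + T = T + S" by transfer (simp add: add.commute)
  show "0 + S = S" by transfer simp
  show "- S + S = 0" unfolding uminus_cblinfun_def by transfer simp
  show "S - T = S + - T" by (simp add: minus_cblinfun_def)
  show C1: "a *\<^sub>C (S + T) = a *\<^sub>C S + a *\<^sub>C T" for a and S T :: "'a \<Rightarrow>\<^sub>C\<^sub>L 'b"
    by transfer (simp add: scaleC_add_right)
  show C2: "(a + b) *\<^sub>C S = a *\<^sub>C S + b *\<^sub>C S" for a b and S :: "'a \<Rightarrow>\<^sub>C\<^sub>L 'b"
    by transfer (simp add: scaleC_add_left)
  show C3: "a *\<^sub>C (b *\<^sub>C S) = (a * b) *\<^sub>C S" for a b and S :: "'a \<Rightarrow>\<^sub>C\<^sub>L 'b"
    by transfer (simp add: scaleC_scaleC)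
  show "r *\<^sub>R S = complex_of_real r *\<^sub>C S" by (simp add: scaleR_cblinfun_def)
  show C4: "norm (a *\<^sub>C S) = cmod a * norm S" for a and S :: "'a \<Rightarrow>\<^sub>C\<^sub>L 'b"
    by transfer (simp add: onorm_scaleC)
  show "r *\<^sub>R (S + T) = r *\<^sub>R S + r *\<^sub>R T" by (simp add: scaleR_cblinfun_def C1)
  show "(r + s) *\<^sub>R S = r *\<^sub>R S + s *\<^sub>R S" by (simp add: scaleR_cblinfun_def C2)
  show "r *\<^sub>R s *\<^sub>R S = (r * s) *\<^sub>R S" by (simp add: scaleR_cblinfun_def C3)
  show "1 *\<^sub>R S = S" unfolding scaleR_cblinfun_def by transfer simp
  show "norm (r *\<^sub>R S) = \<bar>r\<bar> * norm S" by (simp add: scaleR_cblinfun_def C4)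
  show "norm (S + T) \<le> norm S + norm T" by transfer (simp add: onorm_triangle)
  show "norm S = 0 \<longleftrightarrow> S = 0" by transfer (auto simp: onorm_eq_0)
  show "dist S T = norm (S - T)" by (rule dist_cblinfun_def)
  show "sgn S = inverse (norm S) *\<^sub>R S" by (rule sgn_cblinfun_def)
  show "(uniformity :: (('a \<Rightarrow>\<^sub>C\<^sub>L 'b) \<times> ('a \<Rightarrow>\<^sub>C\<^sub>L 'b)) filter) =
    (INF e\<in>{0 <..}. principal {(x, y). dist x y < e})"
    by (rule uniformity_cblinfun_def)
  show "open V = (\<forall>x\<in>V. \<forall>\<^sub>F (x', y) in uniformity. x' = x \<longrightarrow> y \<in> V)"
    by (rule open_cblinfun_def)
qed

end

lemma cblinfun_apply_diff: "cblinfun_apply (S - T) x = cblinfun_apply S x - cblinfun_apply T x"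
  by (simp add: minus_cblinfun_def uminus_cblinfun_def plus_cblinfun.rep_eq scaleC_cblinfun.rep_eq
      del: scaleC_minus_one) simp

instance cblinfun :: (complex_normed_vector, complex_banach) complex_banach
proof
  fix X :: "nat \<Rightarrow> 'a \<Rightarrow>\<^sub>C\<^sub>L 'b"
  assume X: "Cauchy X"
  define B where "B T = Blinfun (cblinfun_apply T)" for T :: "'a \<Rightarrow>\<^sub>C\<^sub>L 'b"
  have B_apply: "blinfun_apply (B T) = cblinfun_apply T" for T
    unfolding B_def by (rule bounded_linear_Blinfun_apply) (rule bounded_linear_cblinfun_apply)
  have dist_B: "dist (B S) (B T) = dist S T" for S T
  proof -
    have "cblinfun_apply (S - T) = blinfun_apply (B S - B T)"
      by (rule ext) (simp add: cblinfun_apply_diff minus_blinfun.rep_eq B_apply)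
    then show ?thesis
      by (simp add: dist_norm norm_blinfun.rep_eq norm_cblinfun.rep_eq)
  qed
  have "Cauchy (\<lambda>n. B (X n))"
    using X by (simp add: Cauchy_def dist_B)
  then obtain L where L: "(\<lambda>n. B (X n)) \<longlonglongrightarrow> L"
    using Cauchy_convergent_iff convergent_def by blast
  have lim: "(\<lambda>n. cblinfun_apply (X n) x) \<longlonglongrightarrow> blinfun_apply L x" for x
    using blinfun.tendsto[OF L tendsto_const[of x]] by (simp add: B_apply)
  have "blinfun_apply L (c *\<^sub>C x) = c *\<^sub>C blinfun_apply L x" for c x
  proof (rule LIMSEQ_unique)
    show "(\<lambda>n. cblinfun_apply (X n) (c *\<^sub>C x)) \<longlonglongrightarrow> blinfun_apply L (c *\<^sub>C x)" by (rule lim)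
    show "(\<lambda>n. cblinfun_apply (X n) (c *\<^sub>C x)) \<longlonglongrightarrow> c *\<^sub>C blinfun_apply L x"
      unfolding cblinfun_apply_scaleC
      by (rule bounded_linear.tendsto[OF bounded_linear_scaleC lim])
  qed
  then have "cblinfun_apply (CBlinfun (blinfun_apply L)) = blinfun_apply L"
    by (intro CBlinfun_inverse) (simp add: blinfun.bounded_linear_right)
  then have "B (CBlinfun (blinfun_apply L)) = L"
    by (intro blinfun_eqI) (simp add: B_apply)
  then have "X \<longlonglongrightarrow> CBlinfun (blinfun_apply L)"
    using L by (simp add: tendsto_iff flip: dist_B)
  then show "convergent X" by (auto simp: convergent_def)
qed


section \<open>Spaces of holomorphic maps on the open unit ball\<close>

text \<open>A map on the open unit ball is represented by the total function that extends it by
  zero, so that equality of representatives is equality of maps on the ball and the pointwise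
  operations are those of the function spaces. The extension does not affect derivatives,
  as the ball is open.\<close>

definition ball_map :: "('a::complex_normed_vector \<Rightarrow> 'b::zero) \<Rightarrow> bool" where
  "ball_map f \<longleftrightarrow> (\<forall>u. u \<notin> ball 0 1 \<longrightarrow> f u = 0)"

definition holomorphic_on_ball ::
    "('a::complex_normed_vector \<Rightarrow> 'b::complex_normed_vector) \<Rightarrow> bool" where
  "holomorphic_on_ball f \<longleftrightarrow>
     (\<forall>u\<in>ball 0 1. \<exists>T :: 'a \<Rightarrow>\<^sub>C\<^sub>L 'b. (f has_derivative cblinfun_apply T) (at u))"

definition differential ::
    "('a::complex_normed_vector \<Rightarrow> 'b::complex_normed_vector) \<Rightarrow> 'a \<Rightarrow> 'a \<Rightarrow>\<^sub>C\<^sub>L 'b" where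
  "differential f u =
     (if u \<in> ball 0 1 then THE T. (f has_derivative cblinfun_apply T) (at u) else 0)"

definition Hinf :: "('a::complex_normed_vector \<Rightarrow> 'b::complex_normed_vector) set" where
  "Hinf = {f. ball_map f \<and> holomorphic_on_ball f \<and> bounded (f ` ball 0 1)}"

definition Hinf_norm :: "('a::complex_normed_vector \<Rightarrow> 'b::complex_normed_vector) \<Rightarrow> real" where
  "Hinf_norm f = (SUP u\<in>ball 0 1. norm (f u))"

definition HL0 :: "('a::complex_normed_vector \<Rightarrow> 'b::complex_normed_vector) set" where
  "HL0 = {f \<in> Hinf. (\<exists>C. C-lipschitz_on (ball 0 1) f) \<and> f 0 = 0}"

definition lip_norm :: "('a::complex_normed_vector \<Rightarrow> 'b::complex_normed_vector) \<Rightarrow> real" where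
  "lip_norm f =
     Sup {norm (f x - f y) / norm (x - y) | x y. x \<in> ball 0 1 \<and> y \<in> ball 0 1 \<and> x \<noteq> y}"

text \<open>\<open>eval_comp x g\<close> is the map written x o g in the literature, sending u to g(u)(x).\<close>

definition eval_comp ::
    "'a::complex_normed_vector \<Rightarrow> ('u \<Rightarrow> 'a \<Rightarrow>\<^sub>C\<^sub>L 'b::complex_normed_vector) \<Rightarrow> 'u \<Rightarrow> 'b" where
  "eval_comp x g = (\<lambda>u. cblinfun_apply (g u) x)"

definition Hinf_s ::
    "(nat \<Rightarrow> 'a) \<Rightarrow> ('a::complex_normed_vector \<Rightarrow> 'a \<Rightarrow>\<^sub>C\<^sub>L 'b::complex_normed_vector) set" where
  "Hinf_s e = {g \<in> Hinf. \<forall>n k.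
     eval_comp (e k) (differential (eval_comp (e n) g)) =
     eval_comp (e n) (differential (eval_comp (e k) g))}"

text \<open>Surjective linear isometry between two spaces of vector-valued functions, each given by
  its carrier and its norm, with the pointwise vector space operations.\<close>

definition isometric_isomorphism ::
    "('u \<Rightarrow> 'v::complex_normed_vector) set \<Rightarrow> (('u \<Rightarrow> 'v) \<Rightarrow> real) \<Rightarrow>
     ('w \<Rightarrow> 'z::complex_normed_vector) set \<Rightarrow> (('w \<Rightarrow> 'z) \<Rightarrow> real) \<Rightarrow>
     (('u \<Rightarrow> 'v) \<Rightarrow> ('w \<Rightarrow> 'z)) \<Rightarrow> bool" where
  "isometric_isomorphism V normV W normW \<Phi> \<longleftrightarrow>
     \<Phi> ` V = W \<and>
     (\<forall>f\<in>V. \<forall>g\<in>V. \<Phi> (\<lambda>u. f u + g u) = (\<lambda>w. \<Phi> f w + \<Phi> g w)) \<and>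
     (\<forall>c. \<forall>f\<in>V. \<Phi> (\<lambda>u. c *\<^sub>C f u) = (\<lambda>w. c *\<^sub>C \<Phi> f w)) \<and>
     (\<forall>f\<in>V. normW (\<Phi> f) = normV f)"

end

theory Submission
  imports Defs "HOL-Complex_Analysis.Cauchy_Integral_Formula"
begin

text \<open>For \<open>f\<close> in the space of Lipschitz maps, the mean value inequality on the convex ball
  and the passage from difference quotients to the derivative show that the best Lipschitz constant
  of \<open>f\<close> is the supremum of the operator norms of its differentials (\<open>HL0_norms\<close>). What
  remains is to identify the range: a bounded holomorphic \<open>g\<close> is a differential exactly when,
  read as a differential form of degree one, it is closed, that is, when
  each \<open>dg(u)\<close> is a symmetric bilinear map. A continuous bilinear map is symmetric as soon as
  it is symmetric on a Schauder basis (\<open>bilinear_symmetric_on_basis\<close>), and this is the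
  condition that defines the target space.

  Holomorphy means Frechet differentiability only, so the central analytic fact is that the
  differential of a bounded holomorphic map is again holomorphic as a map into the space of operators
  (\<open>derivative_holomorphic\<close>). Everything about it is derived from a single inequality,
  \<open>norm (f (v + k) - f v - df(v)(k)) \<le> 8 M / R\<^sup>2 * (norm k)\<^sup>2\<close>,
  valid when \<open>f\<close> is bounded by \<open>M\<close> on the ball of radius \<open>R\<close> about \<open>v\<close> and \<open>k\<close> is
  shorter than \<open>R/2\<close> (\<open>holomorphic_quadratic_estimate\<close>). It holds for scalar functions of one
  variable by Taylor's theorem and Cauchy's bound on the second derivative; a norming functional,
  supplied by the Hahn-Banach theorem, transports it to vector values. The inequality yields a
  Cauchy estimate for differentials, hence closure of holomorphic maps under uniform limits, hence
  holomorphy of each directional derivative as a uniform limit of difference quotients. Applied once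
  more to the directional derivatives it gives an error bound proportional to the length of the
  direction, and so differentiability in the operator norm.

  Symmetry of the second differential comes from the symmetry of second differences
  (\<open>second_derivative_symmetric\<close>). Conversely, a closed form has the primitive
  \<open>x \<mapsto> \<integral>\<^sub>0\<^sup>1 g(tx)(x) dt\<close>, by differentiation under the integral sign
  (\<open>closed_form_primitive\<close>), where continuity of \<open>dg\<close> is again the holomorphy of the
  differential.\<close>

section \<open>Norming functionals\<close>

text \<open>Homogeneity is asked for as an inequality only, which is easier to verify; equality follows by
  scaling back.\<close>

definition sublinear :: "('a::real_vector \<Rightarrow> real) \<Rightarrow> bool" where
  "sublinear p \<longleftrightarrow>
     (\<forall>x y. p (x + y) \<le> p x + p y) \<and> (\<forall>t>0. \<forall>x. p (t *\<^sub>R x) \<le> t * p x)"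

lemma sublinear_add: "sublinear p \<Longrightarrow> p (x + y) \<le> p x + p y"
  by (simp add: sublinear_def)

lemma sublinear_scaleR:
  assumes "sublinear p" "t > 0"
  shows "p (t *\<^sub>R x) = t * p x"
proof (rule antisym)
  show "p (t *\<^sub>R x) \<le> t * p x" using assms by (simp add: sublinear_def)
  have "p (inverse t *\<^sub>R (t *\<^sub>R x)) \<le> inverse t * p (t *\<^sub>R x)"
    using assms by (simp add: sublinear_def del: scaleR_scaleR)
  then show "t * p x \<le> p (t *\<^sub>R x)" using assms(2) by (simp add: field_simps)
qed

lemma sublinear_zero:
  assumes "sublinear p"
  shows "p 0 = 0"
  using sublinear_scaleR[OF assms, of 2 0] by simp

lemma sublinear_minus: "sublinear p \<Longrightarrow> - p (- x) \<le> p x"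
  using sublinear_add[of p x "- x"] sublinear_zero[of p] by simp

lemma sublinear_norm: "sublinear (norm :: 'a::real_normed_vector \<Rightarrow> real)"
  by (simp add: sublinear_def norm_triangle_ineq)

text \<open>The witness is \<open>q x = INF t\<ge>0. p (x + t y) - t p(y)\<close>: with \<open>t = 0\<close> it lies below
  \<open>p\<close>, and \<open>t = 1\<close> gives the bound at \<open>- y\<close>. It serves twice: to force a
  minimal sublinear functional to be odd, and to start the descent from the norm so that the value
  at a prescribed vector is not lost.\<close>

lemma sublinear_descent:
  fixes p :: "'a::real_vector \<Rightarrow> real"
  assumes p: "sublinear p"
  obtains q where "sublinear q" "\<And>x. q x \<le> p x" "q (- y) \<le> - p y"
proof
  define q where "q x = (INF t\<in>{0..}. p (x + t *\<^sub>R y) - t * p y)" for x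
  have scale: "p (t *\<^sub>R y) = t * p y" if "t \<ge> 0" for t
    using that sublinear_scaleR[OF p, of t y] sublinear_zero[OF p] by (cases "t = 0") auto
  have bdd: "bdd_below ((\<lambda>t. p (x + t *\<^sub>R y) - t * p y) ` {0..})" for x
  proof (rule bdd_belowI2)
    fix t :: real assume "t \<in> {0..}"
    then show "- p (- x) \<le> p (x + t *\<^sub>R y) - t * p y"
      using sublinear_add[OF p, of "x + t *\<^sub>R y" "- x"] scale[of t] by simp
  qed
  have le: "q x \<le> p (x + t *\<^sub>R y) - t * p y" if "t \<ge> 0" for x t
    unfolding q_def using that by (intro cINF_lower[OF bdd]) simp
  have ge: "c \<le> q x" if "\<And>t. t \<ge> 0 \<Longrightarrow> c \<le> p (x + t *\<^sub>R y) - t * p y" for c x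
    unfolding q_def using that by (intro cINF_greatest) auto
  show "sublinear q"
    unfolding sublinear_def
  proof (intro conjI allI impI)
    fix x z
    have "q (x + z) - (p (z + s *\<^sub>R y) - s * p y) \<le> q x" if s: "s \<ge> 0" for s
    proof (rule ge)
      fix t :: real assume t: "t \<ge> 0"
      have "q (x + z) \<le> p ((x + t *\<^sub>R y) + (z + s *\<^sub>R y)) - (t + s) * p y"
        using le[of "t + s" "x + z"] s t by (simp add: algebra_simps)
      also have "\<dots> \<le> p (x + t *\<^sub>R y) + p (z + s *\<^sub>R y) - (t + s) * p y"
        using sublinear_add[OF p, of "x + t *\<^sub>R y" "z + s *\<^sub>R y"] by simp
      finally show "q (x + z) - (p (z + s *\<^sub>R y) - s * p y) \<le> p (x + t *\<^sub>R y) - t * p y"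
        by (simp add: algebra_simps)
    qed
    then have "q (x + z) - q x \<le> q z"
      by (intro ge) (simp add: algebra_simps)
    then show "q (x + z) \<le> q x + q z" by simp
  next
    fix s :: real and x assume s: "s > 0"
    have "q (s *\<^sub>R x) / s \<le> q x"
    proof (rule ge)
      fix t :: real assume t: "t \<ge> 0"
      have "q (s *\<^sub>R x) \<le> p (s *\<^sub>R (x + t *\<^sub>R y)) - (s * t) * p y"
        using le[of "s * t" "s *\<^sub>R x"] s t by (simp add: scaleR_add_right)
      also have "\<dots> = s * (p (x + t *\<^sub>R y) - t * p y)"
        unfolding sublinear_scaleR[OF p s] by (simp add: algebra_simps)
      finally show "q (s *\<^sub>R x) / s \<le> p (x + t *\<^sub>R y) - t * p y"
        using s by (simp add: field_simps)
    qed
    then show "q (s *\<^sub>R x) \<le> s * q x" using s by (simp add: field_simps)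
  qed
  show "q x \<le> p x" for x using le[of 0 x] by simp
  show "q (- y) \<le> - p y" using le[of 1 "- y"] sublinear_zero[OF p] by simp
qed

text \<open>Zorn's lemma, downwards: the pointwise infimum of a chain is sublinear, and finite
  because \<open>q x \<ge> - q (- x) \<ge> - p (- x)\<close>.\<close>

lemma minimal_sublinear_exists:
  fixes p :: "'a::real_vector \<Rightarrow> real"
  assumes "sublinear p"
  obtains m where "sublinear m" "m \<le> p" "\<And>q. sublinear q \<Longrightarrow> q \<le> m \<Longrightarrow> q = m"
proof -
  define A where "A = {q. sublinear q \<and> q \<le> p}"
  have "\<exists>m\<in>A. \<forall>q\<in>A. m \<ge> q \<longrightarrow> q = m"
  proof (rule predicate_Zorn)
    show "partial_order_on A (relation_of (\<lambda>x y. x \<ge> y) A)"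
      by (rule partial_order_on_relation_ofI) auto
    fix C assume C: "C \<in> Chains (relation_of (\<lambda>x y. x \<ge> y) A)"
    have CA: "\<And>q. q \<in> C \<Longrightarrow> sublinear q \<and> q \<le> p"
      and tot: "\<And>q r. q \<in> C \<Longrightarrow> r \<in> C \<Longrightarrow> q \<le> r \<or> r \<le> q"
      using C by (auto simp: Chains_def relation_of_def A_def)
    show "\<exists>u\<in>A. \<forall>a\<in>C. a \<ge> u"
    proof (cases "C = {}")
      case True
      then show ?thesis using assms by (auto simp: A_def)
    next
      case False
      define u where "u x = (INF q\<in>C. q x)" for x
      have bdd: "bdd_below ((\<lambda>q. q x) ` C)" for x
      proof (rule bdd_belowI2)
        fix q assume "q \<in> C"
        then show "- p (- x) \<le> q x"
          using CA[of q] sublinear_minus[of q x] by (auto simp: le_fun_def intro: order_trans[rotated])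
      qed
      have le: "u x \<le> q x" if "q \<in> C" for q x
        unfolding u_def using that by (intro cINF_lower[OF bdd])
      have ge: "c \<le> u x" if "\<And>q. q \<in> C \<Longrightarrow> c \<le> q x" for c x
        unfolding u_def using that False by (intro cINF_greatest)
      have "sublinear u"
        unfolding sublinear_def
      proof (intro conjI allI impI)
        fix x y
        have "u (x + y) \<le> q x + r y" if "q \<in> C" "r \<in> C" for q r
        proof -
          \<comment> \<open>The smaller of the two functionals serves both summands.\<close>
          obtain s where s: "s \<in> C" "s \<le> q" "s \<le> r"
            using tot[OF \<open>q \<in> C\<close> \<open>r \<in> C\<close>] \<open>q \<in> C\<close> \<open>r \<in> C\<close> by auto
          have "u (x + y) \<le> s x + s y"
            using le[OF s(1), of "x + y"] sublinear_add[of s x y] CA[OF s(1)] by simp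
          also have "\<dots> \<le> q x + r y" using s by (auto simp: le_fun_def intro!: add_mono)
          finally show ?thesis .
        qed
        then have "u (x + y) - q x \<le> r y" if "q \<in> C" "r \<in> C" for q r
          using that by (simp add: diff_le_eq add.commute)
        then have "u (x + y) - q x \<le> u y" if "q \<in> C" for q
          using that by (intro ge)
        then have "u (x + y) - u y \<le> u x"
          by (intro ge) (simp add: diff_le_eq add.commute)
        then show "u (x + y) \<le> u x + u y" by simp
      next
        fix t :: real and x assume t: "t > 0"
        have "u (t *\<^sub>R x) / t \<le> u x"
        proof (rule ge)
          fix q assume q: "q \<in> C"
          show "u (t *\<^sub>R x) / t \<le> q x"
            using le[OF q, of "t *\<^sub>R x"] sublinear_scaleR[of q t x] CA[OF q] t
            by (simp add: field_simps)
        qed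
        then show "u (t *\<^sub>R x) \<le> t * u x" using t by (simp add: field_simps)
      qed
      moreover have "u \<le> p"
        using False CA le by (metis ex_in_conv le_fun_def order_trans)
      ultimately show ?thesis using le by (auto simp: A_def le_fun_def)
    qed
  qed
  then show ?thesis using that unfolding A_def by (metis (mono_tags, lifting) mem_Collect_eq order_trans)
qed

text \<open>The descent at \<open>x\<close> cannot go strictly below a minimal \<open>m\<close>, so
  \<open>m (- x) \<le> - m x\<close>. An odd subadditive functional is additive. This form of
  the Hahn-Banach argument works with functionals on the whole space and avoids extending partial
  ones.\<close>

lemma minimal_sublinear_linear:
  fixes m :: "'a::real_vector \<Rightarrow> real"
  assumes m: "sublinear m" and min: "\<And>q. sublinear q \<Longrightarrow> q \<le> m \<Longrightarrow> q = m"
  shows "linear m"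
proof -
  have neg: "m (- x) = - m x" for x
  proof -
    obtain q where "sublinear q" "\<And>z. q z \<le> m z" "q (- x) \<le> - m x"
      using sublinear_descent[OF m] by metis
    then have "m (- x) \<le> - m x" using min[of q] by (auto simp: le_fun_def)
    then show ?thesis using sublinear_minus[OF m, of x] by simp
  qed
  show ?thesis
  proof (rule linearI)
    fix x y
    show "m (x + y) = m x + m y"
      using sublinear_add[OF m, of x y] sublinear_add[OF m, of "x + y" "- y"] neg[of y] by simp
  next
    fix t :: real and x
    consider "t > 0" | "t = 0" | "- t > 0" by linarith
    then show "m (t *\<^sub>R x) = t *\<^sub>R m x"
    proof cases
      case 3
      then show ?thesis using sublinear_scaleR[OF m 3, of x] neg[of "t *\<^sub>R x"] by simp
    qed (use sublinear_scaleR[OF m] sublinear_zero[OF m] in auto)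
  qed
qed

text \<open>A linear functional below the descent \<open>q\<close> of the norm at \<open>y\<close> satisfies
  \<open>m (- y) \<le> q (- y) \<le> - norm y\<close>, hence attains the norm at \<open>y\<close>.\<close>

lemma real_norming_functional:
  fixes y :: "'a::real_normed_vector"
  obtains m :: "'a \<Rightarrow> real" where "linear m" "\<And>x. m x \<le> norm x" "m y = norm y"
proof -
  obtain q :: "'a \<Rightarrow> real" where q: "sublinear q" "\<And>x. q x \<le> norm x" "q (- y) \<le> - norm y"
    using sublinear_descent[OF sublinear_norm] by metis
  obtain m where m: "sublinear m" "m \<le> q" "\<And>r. sublinear r \<Longrightarrow> r \<le> m \<Longrightarrow> r = m"
    using minimal_sublinear_exists[OF q(1)] by metis
  have lin: "linear m" by (rule minimal_sublinear_linear[OF m(1,3)])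
  have le: "m x \<le> norm x" for x using m(2) q(2) by (auto simp: le_fun_def intro: order_trans)
  have "m (- y) \<le> - norm y" using m(2) q(3) by (auto simp: le_fun_def intro: order_trans)
  then have "m y = norm y" using linear_neg[OF lin, of y] le[of y] by simp
  with lin le show ?thesis by (rule that)
qed

text \<open>A real functional \<open>m\<close> is the real part of the complex-linear functional
  \<open>x \<mapsto> m x - \<i> m(\<i> x)\<close>, which satisfies the same norm bound.\<close>

lemma norming_functional:
  fixes y :: "'a::complex_normed_vector"
  obtains \<psi> :: "'a \<Rightarrow>\<^sub>C\<^sub>L complex"
  where "\<And>x. cmod (cblinfun_apply \<psi> x) \<le> norm x" "cblinfun_apply \<psi> y = complex_of_real (norm y)"
proof -
  obtain m :: "'a \<Rightarrow> real" where m: "linear m" "\<And>x. m x \<le> norm x" "m y = norm y"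
    using real_norming_functional by metis
  define F where "F x = Complex (m x) (- m (\<i> *\<^sub>C x))" for x
  have add: "F (x + z) = F x + F z" for x z
    by (simp add: F_def complex_eq_iff scaleC_add_right linear_add[OF m(1)])
  have scaleC: "F (c *\<^sub>C x) = c * F x" for c x
  proof -
    have split: "a *\<^sub>C x = Re a *\<^sub>R x + Im a *\<^sub>R (\<i> *\<^sub>C x)" for a
      by (simp add: scaleR_scaleC scaleC_scaleC mult.commute complex_eq[symmetric]
          flip: scaleC_add_left)
    have "m (c *\<^sub>C x) = Re c * m x + Im c * m (\<i> *\<^sub>C x)"
      by (subst split) (simp add: linear_add[OF m(1)] linear_scale[OF m(1)])
    moreover have "m (\<i> *\<^sub>C c *\<^sub>C x) = - Im c * m x + Re c * m (\<i> *\<^sub>C x)"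
      by (subst scaleC_scaleC, subst split) (simp add: linear_add[OF m(1)] linear_scale[OF m(1)]
          linear_neg[OF m(1)] linear_diff[OF m(1)])
    ultimately show ?thesis by (simp add: F_def complex_eq_iff algebra_simps)
  qed
  have bound: "cmod (F x) \<le> norm x" for x
  proof -
    \<comment> \<open>Rotating \<open>x\<close> makes \<open>F x\<close> real and nonnegative, where it is a value of \<open>m\<close>.\<close>
    define c where "c = cnj (sgn (F x))"
    have "F (c *\<^sub>C x) = complex_of_real (cmod (F x))"
    proof (cases "F x = 0")
      case False
      then show ?thesis
        unfolding scaleC c_def
        using complex_norm_square[of "F x"]
        by (simp add: sgn_div_norm scaleR_conv_of_real power2_eq_square field_simps)
    qed (simp add: scaleC)
    then have "cmod (F x) = m (c *\<^sub>C x)" by (simp add: F_def complex_eq_iff)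
    also have "\<dots> \<le> cmod c * norm x" using m(2) by (simp flip: norm_scaleC)
    also have "\<dots> \<le> norm x"
      by (simp add: c_def norm_sgn)
    finally show ?thesis .
  qed
  have "bounded_linear F"
  proof (rule bounded_linear_intro[where K = 1])
    show "F (r *\<^sub>R x) = r *\<^sub>R F x" for r x
      by (simp add: scaleR_scaleC scaleC scaleR_conv_of_real scaleC_complex_def)
  qed (use add bound in auto)
  then have rep: "cblinfun_apply (CBlinfun F) = F"
    by (intro CBlinfun_inverse) (simp add: scaleC scaleC_complex_def)
  have "Re (F y) = norm y" by (simp add: F_def m(3))
  moreover have "(Re (F y))\<^sup>2 + (Im (F y))\<^sup>2 \<le> (norm y)\<^sup>2"
    using bound[of y] by (metis cmod_power2 norm_ge_zero power_mono)
  ultimately have "F y = complex_of_real (norm y)" by (simp add: complex_eq_iff)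
  with bound show ?thesis by (intro that[of "CBlinfun F"]) (simp_all add: rep)
qed

section \<open>Operators and their derivatives\<close>

lemma scaleC_zero_left [simp]: "0 *\<^sub>C (x::'a::complex_normed_vector) = 0"
  using scaleR_scaleC[of 0 x] by simp

lemma cblinfun_eqI: "(\<And>x. cblinfun_apply S x = cblinfun_apply T x) \<Longrightarrow> S = T"
  by (metis cblinfun_apply_inverse ext)

lemma cblinfun_apply_scaleR: "cblinfun_apply (r *\<^sub>R T) x = r *\<^sub>R cblinfun_apply T x"
  by (simp add: scaleR_scaleC scaleC_cblinfun.rep_eq)

lemma norm_cblinfun_apply: "norm (cblinfun_apply T x) \<le> norm T * norm x"
  unfolding norm_cblinfun.rep_eq by (rule onorm[OF bounded_linear_cblinfun_apply])

lemma norm_cblinfun_bound: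
  "0 \<le> b \<Longrightarrow> (\<And>x. norm (cblinfun_apply T x) \<le> b * norm x) \<Longrightarrow> norm T \<le> b"
  unfolding norm_cblinfun.rep_eq by (rule onorm_bound)

lemma bounded_bilinear_cblinfun_apply: "bounded_bilinear cblinfun_apply"
  by (rule bounded_bilinear.intro)
     (auto simp: plus_cblinfun.rep_eq cblinfun_apply_scaleR linear_simps[OF bounded_linear_cblinfun_apply]
        intro!: exI[of _ 1] norm_cblinfun_apply)

lemma cblinfun_of_bilinear:
  fixes B :: "'a::complex_normed_vector \<Rightarrow> 'b::complex_normed_vector \<Rightarrow> 'c::complex_normed_vector"
  assumes B: "bounded_bilinear B"
    and scaleC_left: "\<And>c x y. B (c *\<^sub>C x) y = c *\<^sub>C B x y"
    and scaleC_right: "\<And>c x y. B x (c *\<^sub>C y) = c *\<^sub>C B x y"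
  obtains T :: "'a \<Rightarrow>\<^sub>C\<^sub>L ('b \<Rightarrow>\<^sub>C\<^sub>L 'c)" where "\<And>x y. cblinfun_apply (cblinfun_apply T x) y = B x y"
proof
  obtain K where K: "K \<ge> 0" "\<And>x y. norm (B x y) \<le> norm x * norm y * K"
    using bounded_bilinear.nonneg_bounded[OF B] by metis
  define L where "L x = CBlinfun (B x)" for x
  have L: "cblinfun_apply (L x) = B x" for x
    unfolding L_def
    by (intro CBlinfun_inverse) (simp add: scaleC_right bounded_bilinear.bounded_linear_right[OF B])
  have "bounded_linear L"
  proof (rule bounded_linear_intro[where K = K])
    show "L (x + y) = L x + L y" for x y
      by (rule cblinfun_eqI) (simp add: L plus_cblinfun.rep_eq bounded_bilinear.add_left[OF B])
    show "L (r *\<^sub>R x) = r *\<^sub>R L x" for r x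
      by (rule cblinfun_eqI) (simp add: L cblinfun_apply_scaleR bounded_bilinear.scaleR_left[OF B])
    show "norm (L x) \<le> norm x * K" for x
      using K by (intro norm_cblinfun_bound) (auto simp: L mult.assoc mult.commute[of K])
  qed
  moreover have "L (c *\<^sub>C x) = c *\<^sub>C L x" for c x
    by (rule cblinfun_eqI) (simp add: L scaleC_cblinfun.rep_eq scaleC_left)
  ultimately have "cblinfun_apply (CBlinfun L) = L"
    by (intro CBlinfun_inverse) simp
  then show "cblinfun_apply (cblinfun_apply (CBlinfun L) x) y = B x y" for x y by (simp add: L)
qed

lemma has_derivative_cblinfun_diff:
  assumes "(f has_derivative cblinfun_apply S) F" "(g has_derivative cblinfun_apply T) F"
  shows "((\<lambda>x. f x - g x) has_derivative cblinfun_apply (S - T)) F"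
proof -
  have "cblinfun_apply (S - T) = (\<lambda>x. cblinfun_apply S x - cblinfun_apply T x)"
    by (rule ext) (rule cblinfun_apply_diff)
  then show ?thesis using has_derivative_diff[OF assms] by simp
qed

lemma has_derivative_cblinfun_unique:
  assumes "(f has_derivative cblinfun_apply S) (at u)" "(f has_derivative cblinfun_apply T) (at u)"
  shows "S = T"
  using has_derivative_unique[OF assms] by (simp add: cblinfun_apply_inject)

lemma has_derivative_quadratic:
  fixes f :: "'a::real_normed_vector \<Rightarrow> 'b::real_normed_vector"
  assumes "bounded_linear T" "d > 0"
    and le: "\<And>k. norm k < d \<Longrightarrow> norm (f (v + k) - f v - T k) \<le> C * (norm k)\<^sup>2"
  shows "(f has_derivative T) (at v)"
  unfolding has_derivative_at
proof (intro conjI assms(1))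
  have "((\<lambda>k::'a. C * norm k) \<longlongrightarrow> C * norm (0::'a)) (at 0)" 
    by (rule tendsto_mult[OF tendsto_const tendsto_norm[OF tendsto_ident_at]])
  then have lim: "((\<lambda>k::'a. C * norm k) \<longlongrightarrow> 0) (at 0)" by simp
  show "(\<lambda>k. norm (f (v + k) - f v - T k) / norm k) \<midarrow>0\<rightarrow> 0"
  proof (rule Lim_null_comparison[OF _ lim])
    have "norm (norm (f (v + k) - f v - T k) / norm k) \<le> C * norm k"
      if "k \<noteq> 0" "dist k 0 < d" for k
      using le[of k] that by (simp add: field_simps power2_eq_square)
    then show "\<forall>\<^sub>F k in at 0. norm (norm (f (v + k) - f v - T k) / norm k) \<le> C * norm k"
      using \<open>d > 0\<close> unfolding eventually_at by blast
  qed
qed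

lemma mem_ball_shift: "v + x \<in> ball v r \<longleftrightarrow> norm x < r" for v :: "'a::real_normed_vector"
  by (simp add: dist_norm)

section \<open>Second-order and Cauchy estimates for holomorphic maps\<close>

text \<open>Frechet holomorphy on an arbitrary set, so that estimates can be localised to
  balls inside the domain.\<close>

definition holomorphic_map_on ::
    "'a::complex_normed_vector set \<Rightarrow> ('a \<Rightarrow> 'b::complex_normed_vector) \<Rightarrow> bool" where
  "holomorphic_map_on S f \<longleftrightarrow>
     (\<forall>u\<in>S. \<exists>T :: 'a \<Rightarrow>\<^sub>C\<^sub>L 'b. (f has_derivative cblinfun_apply T) (at u))"

text \<open>Cauchy's inequality on discs of radius \<open>\<rho>/2\<close> bounds the second derivative
  by \<open>2 M / (\<rho>/2)\<^sup>2\<close> on the half-sized disc; Taylor's theorem does the rest.\<close>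

lemma scalar_quadratic_estimate:
  assumes holo: "\<phi> holomorphic_on ball 0 \<rho>"
    and M: "\<And>z. z \<in> ball 0 \<rho> \<Longrightarrow> cmod (\<phi> z) \<le> M"
    and z: "cmod z < \<rho> / 2"
  shows "cmod (\<phi> z - \<phi> 0 - deriv \<phi> 0 * z) \<le> 8 * M / \<rho>\<^sup>2 * (cmod z)\<^sup>2"
proof -
  have \<rho>: "\<rho> > 0" using z norm_ge_zero[of z] by linarith
  have sub: "cball x (\<rho> / 2) \<subseteq> ball 0 \<rho>" if "x \<in> ball 0 (\<rho> / 2)" for x :: complex
  proof
    fix y assume "y \<in> cball x (\<rho> / 2)"
    then show "y \<in> ball 0 \<rho>"
      using that dist_triangle[of 0 y x] by simp
  qed
  have B: "cmod ((deriv ^^ 2) \<phi> x) \<le> 8 * M / \<rho>\<^sup>2" if x: "x \<in> ball 0 (\<rho> / 2)" for x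
  proof -
    have "cmod ((deriv ^^ 2) \<phi> x) \<le> fact 2 * M / (\<rho> / 2) ^ 2"
    proof (rule Cauchy_inequality)
      show "\<phi> holomorphic_on ball x (\<rho> / 2)"
        using holo by (rule holomorphic_on_subset) (use sub[OF x] ball_subset_cball in blast)
      show "continuous_on (cball x (\<rho> / 2)) \<phi>"
        using holomorphic_on_imp_continuous_on[OF holo] by (rule continuous_on_subset) (rule sub[OF x])
      show "cmod (\<phi> y) \<le> M" if "cmod (x - y) = \<rho> / 2" for y
        using that sub[OF x] by (intro M) (auto simp: dist_norm)
    qed (use \<rho> in simp)
    also have "\<dots> = 8 * M / \<rho>\<^sup>2" by (simp add: power2_eq_square)
    finally show ?thesis .
  qed
  have D: "((deriv ^^ i) \<phi> has_field_derivative (deriv ^^ Suc i) \<phi> x) (at x within ball 0 (\<rho> / 2))"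
    if x: "x \<in> ball 0 (\<rho> / 2)" for x i
  proof -
    have "((deriv ^^ i) \<phi>) holomorphic_on ball 0 \<rho>"
      using holo by (rule holomorphic_higher_deriv) simp
    moreover have "x \<in> ball 0 \<rho>" using x \<rho> by simp
    ultimately have "((deriv ^^ i) \<phi> has_field_derivative deriv ((deriv ^^ i) \<phi>) x) (at x)"
      by (intro holomorphic_derivI) auto
    then show ?thesis using has_field_derivative_at_within by simp
  qed
  have "cmod ((deriv ^^ 0) \<phi> z - (\<Sum>i\<le>1. (deriv ^^ i) \<phi> 0 * (z - 0) ^ i / (fact i)))
      \<le> 8 * M / \<rho>\<^sup>2 * cmod (z - 0) ^ (Suc 1) / fact 1"
    by (rule complex_Taylor[of "ball 0 (\<rho> / 2)"]) (use D B z \<rho> in \<open>auto simp: numeral_2_eq_2\<close>)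
  then show ?thesis by (simp add: diff_diff_eq numeral_2_eq_2)
qed

text \<open>Compose \<open>f\<close> with the complex line through \<open>v\<close> in direction \<open>k\<close> and
  with a functional that norms the remainder. The line stays in the ball for parameters of modulus
  less than \<open>R / norm k > 2\<close>, so the scalar estimate applies at the parameter \<open>1\<close>.\<close>

lemma holomorphic_quadratic_estimate:
  fixes f :: "'a::complex_normed_vector \<Rightarrow> 'b::complex_normed_vector"
  assumes holo: "holomorphic_map_on (ball v R) f"
    and M: "\<And>x. x \<in> ball v R \<Longrightarrow> norm (f x) \<le> M"
    and T: "(f has_derivative cblinfun_apply T) (at v)"
    and k: "norm k < R / 2"
  shows "norm (f (v + k) - f v - cblinfun_apply T k) \<le> 8 * M / R\<^sup>2 * (norm k)\<^sup>2"
proof (cases "k = 0")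
  case True
  then show ?thesis using linear_simps(3)[OF bounded_linear_cblinfun_apply[of T]] by simp
next
  case False
  define y where "y = f (v + k) - f v - cblinfun_apply T k"
  obtain \<psi> :: "'b \<Rightarrow>\<^sub>C\<^sub>L complex" where \<psi>: "\<And>x. cmod (cblinfun_apply \<psi> x) \<le> norm x"
    "cblinfun_apply \<psi> y = complex_of_real (norm y)"
    using norming_functional by metis
  define \<phi> where "\<phi> \<zeta> = cblinfun_apply \<psi> (f (v + \<zeta> *\<^sub>C k))" for \<zeta>
  define \<rho> where "\<rho> = R / norm k"
  have \<rho>: "\<rho> > 2" using k False by (simp add: \<rho>_def field_simps)
  have line: "bounded_linear (\<lambda>\<zeta>::complex. \<zeta> *\<^sub>C k)"
    by (rule bounded_linear_intro[where K = "norm k"])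
       (simp_all add: scaleC_add_left scaleR_scaleC[of _ k] scaleR_scaleC[of _ "_ *\<^sub>C k"] scaleC_scaleC
         norm_scaleC scaleR_conv_of_real)
  have inball: "v + \<zeta> *\<^sub>C k \<in> ball v R" if "\<zeta> \<in> ball 0 \<rho>" for \<zeta>
    using that False by (simp add: \<rho>_def dist_norm norm_scaleC field_simps)
  have deriv: "(\<phi> has_field_derivative cblinfun_apply \<psi> (cblinfun_apply S k)) (at \<zeta>)"
    if "(f has_derivative cblinfun_apply S) (at (v + \<zeta> *\<^sub>C k))" for S \<zeta>
  proof -
    have "((\<lambda>\<zeta>. v + \<zeta> *\<^sub>C k) has_derivative (\<lambda>w. w *\<^sub>C k)) (at \<zeta>)"
      using has_derivative_add[OF has_derivative_const bounded_linear_imp_has_derivative[OF line]]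
      by simp
    from has_derivative_compose[OF this that]
    have "(\<phi> has_derivative (\<lambda>w. cblinfun_apply \<psi> (cblinfun_apply S (w *\<^sub>C k)))) (at \<zeta>)"
      unfolding \<phi>_def by (rule bounded_linear.has_derivative[OF bounded_linear_cblinfun_apply])
    then show ?thesis
      unfolding has_field_derivative_def
      by (simp add: cblinfun_apply_scaleC scaleC_complex_def mult.commute[of _ "cblinfun_apply \<psi> _"])
  qed
  have "cmod (\<phi> 1 - \<phi> 0 - deriv \<phi> 0 * 1) \<le> 8 * M / \<rho>\<^sup>2 * (cmod 1)\<^sup>2"
  proof (rule scalar_quadratic_estimate)
    show "\<phi> holomorphic_on ball 0 \<rho>"
      unfolding holomorphic_on_open[OF open_ball]
      using holo inball deriv unfolding holomorphic_map_on_def by blast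
    show "cmod (\<phi> z) \<le> M" if "z \<in> ball 0 \<rho>" for z
      unfolding \<phi>_def using \<psi>(1) M[OF inball[OF that]] by (rule order_trans)
  qed (use \<rho> in simp)
  moreover have "deriv \<phi> 0 = cblinfun_apply \<psi> (cblinfun_apply T k)"
    by (rule DERIV_imp_deriv, rule deriv) (use T in simp)
  moreover have "\<phi> 1 - \<phi> 0 - cblinfun_apply \<psi> (cblinfun_apply T k) = cblinfun_apply \<psi> y"
    by (simp add: \<phi>_def y_def linear_simps[OF bounded_linear_cblinfun_apply])
  ultimately have "norm y \<le> 8 * M / \<rho>\<^sup>2"
    by (simp add: \<psi>(2))
  also have "\<dots> = 8 * M / R\<^sup>2 * (norm k)\<^sup>2" by (simp add: \<rho>_def power_divide)
  finally show ?thesis by (simp add: y_def)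
qed

text \<open>Follows from the quadratic estimate with a step of length \<open>R/4\<close>: all terms other than
  the derivative are bounded by multiples of \<open>M\<close>. The constant is not sharp.\<close>

lemma cauchy_estimate:
  fixes f :: "'a::complex_normed_vector \<Rightarrow> 'b::complex_normed_vector"
  assumes holo: "holomorphic_map_on (ball v R) f" and R: "R > 0"
    and M: "\<And>x. x \<in> ball v R \<Longrightarrow> norm (f x) \<le> M"
    and T: "(f has_derivative cblinfun_apply T) (at v)"
  shows "norm T \<le> 10 * M / R"
proof -
  have M0: "M \<ge> 0" using M[of v] R norm_ge_zero[of "f v"] by (simp del: norm_ge_zero)
  have "norm (cblinfun_apply T k) \<le> 10 * M / R * norm k" for k
  proof (cases "k = 0")
    case True
    then show ?thesis using linear_simps(3)[OF bounded_linear_cblinfun_apply[of T]] by simp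
  next
    case False
    define c where "c = R / (4 * norm k)"
    have c: "c > 0" "norm (c *\<^sub>R k) = R / 4" using False R by (auto simp: c_def)
    have "norm (f (v + c *\<^sub>R k) - f v - cblinfun_apply T (c *\<^sub>R k)) \<le> 8 * M / R\<^sup>2 * (norm (c *\<^sub>R k))\<^sup>2"
      by (rule holomorphic_quadratic_estimate[OF holo M T]) (use c R in auto)
    also have "\<dots> = M / 2" using R unfolding c(2) by (simp add: power2_eq_square)
    finally have "norm (f (v + c *\<^sub>R k) - f v - cblinfun_apply T (c *\<^sub>R k)) \<le> M / 2" .
    moreover have "norm (f (v + c *\<^sub>R k)) \<le> M"
      using c(2) R by (intro M) (simp add: dist_norm del: norm_scaleR)
    moreover have "norm (f v) \<le> M" using R by (intro M) simp
    ultimately have "norm (cblinfun_apply T (c *\<^sub>R k)) \<le> 5 / 2 * M"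
      using norm_triangle_ineq4[of "f (v + c *\<^sub>R k) - f v" "f (v + c *\<^sub>R k) - f v - cblinfun_apply T (c *\<^sub>R k)"]
        norm_triangle_ineq4[of "f (v + c *\<^sub>R k)" "f v"] by simp
    then show ?thesis
      using c False R by (simp add: linear_simps[OF bounded_linear_cblinfun_apply] c_def field_simps)
  qed
  then have "onorm (cblinfun_apply T) \<le> 10 * M / R"
    using M0 R by (intro onorm_bound) auto
  then show ?thesis by (simp add: norm_cblinfun.rep_eq)
qed

section \<open>Holomorphy of the differential\<close>

text \<open>The Weierstrass theorem, localised at one point: the derivatives of the \<open>F n\<close> at \<open>v\<close>
  converge, and the quadratic estimate, uniform in \<open>n\<close>, survives the limit.\<close>

lemma holomorphic_uniform_limit:
  fixes f :: "'a::complex_normed_vector \<Rightarrow> 'b::complex_banach"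
  assumes holo: "\<forall>\<^sub>F n in sequentially. holomorphic_map_on (ball v R) (F n)"
    and lim: "uniform_limit (ball v R) F f sequentially"
    and M: "\<And>x. x \<in> ball v R \<Longrightarrow> norm (f x) \<le> M" and R: "R > 0"
  obtains T :: "'a \<Rightarrow>\<^sub>C\<^sub>L 'b" where "(f has_derivative cblinfun_apply T) (at v)"
proof -
  have "\<forall>\<^sub>F n in sequentially. \<forall>x\<in>ball v R. dist (F n x) (f x) < 1"
    using lim by (rule uniform_limitD) simp
  from eventually_conj[OF holo this] obtain N where N:
    "\<And>n. n \<ge> N \<Longrightarrow> holomorphic_map_on (ball v R) (F n)"
    "\<And>n x. n \<ge> N \<Longrightarrow> x \<in> ball v R \<Longrightarrow> dist (F n x) (f x) < 1"
    unfolding eventually_sequentially by blast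
  have FM: "norm (F n x) \<le> M + 1" if "n \<ge> N" "x \<in> ball v R" for n x
    using N(2)[OF that] M[OF that(2)] norm_triangle_sub[of "F n x" "f x"] by (simp add: dist_norm)
  have "\<forall>n. \<exists>T :: 'a \<Rightarrow>\<^sub>C\<^sub>L 'b. n \<ge> N \<longrightarrow> (F n has_derivative cblinfun_apply T) (at v)"
    using N(1) R unfolding holomorphic_map_on_def by (metis centre_in_ball)
  then obtain T :: "nat \<Rightarrow> 'a \<Rightarrow>\<^sub>C\<^sub>L 'b"
    where T: "\<And>n. n \<ge> N \<Longrightarrow> (F n has_derivative cblinfun_apply (T n)) (at v)" by metis
  \<comment> \<open>The Cauchy estimate applied to \<open>F m - F n\<close> makes the derivatives at \<open>v\<close> a Cauchy sequence.\<close>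
  have "Cauchy T"
  proof (rule metric_CauchyI)
    fix \<epsilon> :: real assume \<epsilon>: "\<epsilon> > 0"
    define \<delta> where "\<delta> = \<epsilon> * R / 40"
    have \<delta>: "\<delta> > 0" using \<epsilon> R by (simp add: \<delta>_def)
    have "\<forall>\<^sub>F n in sequentially. \<forall>x\<in>ball v R. dist (F n x) (f x) < \<delta>"
      using lim \<delta> by (rule uniform_limitD)
    then obtain N' where N': "\<And>n x. n \<ge> N' \<Longrightarrow> x \<in> ball v R \<Longrightarrow> dist (F n x) (f x) < \<delta>"
      unfolding eventually_sequentially by blast
    have "dist (T m) (T n) < \<epsilon>" if m: "m \<ge> max N N'" and n: "n \<ge> max N N'" for m n
    proof -
      have "norm (T m - T n) \<le> 10 * (2 * \<delta>) / R"
      proof (rule cauchy_estimate[OF _ R])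
        show "holomorphic_map_on (ball v R) (\<lambda>x. F m x - F n x)"
          using N(1)[of m] N(1)[of n] m n has_derivative_cblinfun_diff
          unfolding holomorphic_map_on_def by (metis max.bounded_iff)
        show "norm (F m x - F n x) \<le> 2 * \<delta>" if "x \<in> ball v R" for x
          using N'[of m x] N'[of n x] that m n dist_triangle2[of "F m x" "F n x" "f x"]
          by (simp add: dist_norm)
        show "((\<lambda>x. F m x - F n x) has_derivative cblinfun_apply (T m - T n)) (at v)"
          using T m n by (intro has_derivative_cblinfun_diff) auto
      qed
      also have "\<dots> < \<epsilon>" using \<epsilon> R by (simp add: \<delta>_def)
      finally show ?thesis by (simp add: dist_norm)
    qed
    then show "\<exists>K. \<forall>m\<ge>K. \<forall>n\<ge>K. dist (T m) (T n) < \<epsilon>" by blast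
  qed
  then obtain L where L: "T \<longlonglongrightarrow> L" using Cauchy_convergent_iff convergent_def by blast
  have ptw: "(\<lambda>n. F n x) \<longlonglongrightarrow> f x" if "x \<in> ball v R" for x
    using tendsto_uniform_limitI[OF lim that] .
  have "(f has_derivative cblinfun_apply L) (at v)"
  proof (rule has_derivative_quadratic[OF bounded_linear_cblinfun_apply])
    show "R / 2 > 0" using R by simp
    fix k :: 'a assume k: "norm k < R / 2"
    have "(\<lambda>n. norm (F n (v + k) - F n v - cblinfun_apply (T n) k))
        \<longlonglongrightarrow> norm (f (v + k) - f v - cblinfun_apply L k)"
      by (intro tendsto_intros ptw bounded_bilinear.tendsto[OF bounded_bilinear_cblinfun_apply] L)
         (use k R in \<open>auto simp: dist_norm\<close>)
    then show "norm (f (v + k) - f v - cblinfun_apply L k) \<le> 8 * (M + 1) / R\<^sup>2 * (norm k)\<^sup>2"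
    proof (rule Lim_bounded[where M = N], intro allI impI)
      fix n assume n: "n \<ge> N"
      show "norm (F n (v + k) - F n v - cblinfun_apply (T n) k) \<le> 8 * (M + 1) / R\<^sup>2 * (norm k)\<^sup>2"
        by (rule holomorphic_quadratic_estimate[OF N(1)[OF n] FM[OF n] T[OF n] k])
    qed
  qed
  then show ?thesis by (rule that)
qed

text \<open>The quadratic estimate holds uniformly in the base point, so the
  difference quotients with step \<open>h/(n+1)\<close>, which are holomorphic in \<open>u\<close>, converge uniformly to
  the directional derivative.\<close>

lemma directional_derivative_holomorphic:
  fixes f :: "'a::complex_normed_vector \<Rightarrow> 'b::complex_banach"
  assumes D: "\<And>u. u \<in> ball v (2 * R) \<Longrightarrow> (f has_derivative cblinfun_apply (D u)) (at u)"
    and M: "\<And>u. u \<in> ball v (2 * R) \<Longrightarrow> norm (f u) \<le> M" and R: "R > 0"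
  obtains T :: "'a \<Rightarrow>\<^sub>C\<^sub>L 'b"
  where "((\<lambda>u. cblinfun_apply (D u) h) has_derivative cblinfun_apply T) (at v)"
proof -
  define F where "F n u = real (Suc n) *\<^sub>R (f (u + h /\<^sub>R real (Suc n)) - f u)" for n u
  have sub: "ball u R \<subseteq> ball v (2 * R)" if "u \<in> ball v R" for u
  proof
    fix x assume "x \<in> ball u R"
    then show "x \<in> ball v (2 * R)" using that dist_triangle[of v x u] by simp
  qed
  have holo: "holomorphic_map_on (ball u R) f" if "u \<in> ball v R" for u
    using D sub[OF that] unfolding holomorphic_map_on_def by blast
  have Du: "(f has_derivative cblinfun_apply (D u)) (at u)" if "u \<in> ball v R" for u
    using sub[OF that] R by (intro D) (metis centre_in_ball subsetD)
  have ev: "\<forall>\<^sub>F n in sequentially. norm (h /\<^sub>R real (Suc n)) < R / 2"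
  proof -
    have "(\<lambda>n. norm (h /\<^sub>R real (Suc n))) \<longlonglongrightarrow> norm (0 *\<^sub>R h)"
      by (intro tendsto_intros LIMSEQ_inverse_real_of_nat)
    then show ?thesis using R by (intro order_tendstoD(2)) auto
  qed
  have "\<forall>\<^sub>F n in sequentially. holomorphic_map_on (ball v R) (F n)"
    using ev
  proof eventually_elim
    case (elim n)
    show ?case
      unfolding holomorphic_map_on_def
    proof
      fix u assume u: "u \<in> ball v R"
      let ?c = "h /\<^sub>R real (Suc n)"
      have "u + ?c \<in> ball v (2 * R)"
        by (rule subsetD[OF sub[OF u]]) (use elim R in \<open>simp add: dist_norm\<close>)
      then have "(f has_derivative cblinfun_apply (D (u + ?c))) (at (u + ?c))" by (rule D)
      moreover have "((\<lambda>u. u + ?c) has_derivative (\<lambda>x. x)) (at u)"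
        by (auto intro!: derivative_eq_intros)
      ultimately have "((\<lambda>u. f (u + ?c)) has_derivative cblinfun_apply (D (u + ?c))) (at u)"
        using has_derivative_compose by fastforce
      from has_derivative_scaleR_right[OF has_derivative_cblinfun_diff[OF this Du[OF u]], of "real (Suc n)"]
      have "(F n has_derivative cblinfun_apply (real (Suc n) *\<^sub>R (D (u + ?c) - D u))) (at u)"
        unfolding F_def by (simp add: cblinfun_apply_scaleR[abs_def])
      then show "\<exists>T. (F n has_derivative cblinfun_apply T) (at u)" by blast
    qed
  qed
  moreover have "uniform_limit (ball v R) F (\<lambda>u. cblinfun_apply (D u) h) sequentially"
  proof (rule uniform_limitI)
    fix \<epsilon> :: real assume "\<epsilon> > 0"
    have "(\<lambda>n. 8 * M / R\<^sup>2 * (norm h)\<^sup>2 * inverse (real (Suc n))) \<longlonglongrightarrow> 8 * M / R\<^sup>2 * (norm h)\<^sup>2 * 0"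
      by (intro tendsto_intros LIMSEQ_inverse_real_of_nat)
    then have "\<forall>\<^sub>F n in sequentially. 8 * M / R\<^sup>2 * (norm h)\<^sup>2 * inverse (real (Suc n)) < \<epsilon>"
      using \<open>\<epsilon> > 0\<close> by (intro order_tendstoD(2)) auto
    with ev show "\<forall>\<^sub>F n in sequentially. \<forall>u\<in>ball v R. dist (F n u) (cblinfun_apply (D u) h) < \<epsilon>"
    proof eventually_elim
      case (elim n)
      show ?case
      proof
        fix u assume u: "u \<in> ball v R"
        define s where "s = inverse (real (Suc n))"
        have s: "s > 0" "real (Suc n) = inverse s" by (auto simp: s_def)
        have "norm (f (u + s *\<^sub>R h) - f u - cblinfun_apply (D u) (s *\<^sub>R h))
            \<le> 8 * M / R\<^sup>2 * (norm (s *\<^sub>R h))\<^sup>2"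
          using elim(1) sub[OF u]
          by (intro holomorphic_quadratic_estimate[OF holo[OF u] M Du[OF u]]) (auto simp: s_def)
        also have "\<dots> = s * (8 * M / R\<^sup>2 * (norm h)\<^sup>2 * s)"
          using s(1) by (simp add: power2_eq_square)
        finally have "inverse s * norm (f (u + s *\<^sub>R h) - f u - cblinfun_apply (D u) (s *\<^sub>R h))
            \<le> 8 * M / R\<^sup>2 * (norm h)\<^sup>2 * s"
          using s(1) by (simp add: field_simps)
        also have "\<dots> < \<epsilon>" using elim(2) by (simp add: s_def)
        also have "inverse s * norm (f (u + s *\<^sub>R h) - f u - cblinfun_apply (D u) (s *\<^sub>R h))
            = norm (inverse s *\<^sub>R (f (u + s *\<^sub>R h) - f u - cblinfun_apply (D u) (s *\<^sub>R h)))"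
          using s(1) by simp
        also have "inverse s *\<^sub>R (f (u + s *\<^sub>R h) - f u - cblinfun_apply (D u) (s *\<^sub>R h))
            = F n u - cblinfun_apply (D u) h"
          using s(1) unfolding F_def s_def[symmetric] s(2)
          by (simp add: scaleR_diff_right linear_simps[OF bounded_linear_cblinfun_apply])
        finally show "dist (F n u) (cblinfun_apply (D u) h) < \<epsilon>" by (simp add: dist_norm)
      qed
    qed
  qed
  moreover have "norm (cblinfun_apply (D u) h) \<le> 10 * M / R * norm h" if u: "u \<in> ball v R" for u
  proof -
    have "norm (D u) \<le> 10 * M / R"
      using sub[OF u] by (intro cauchy_estimate[OF holo[OF u] R M Du[OF u]]) auto
    then show ?thesis
      using norm_cblinfun_apply[of "D u" h] by (meson mult_right_mono norm_ge_zero order_trans)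
  qed
  ultimately show ?thesis using R that by (rule holomorphic_uniform_limit)
qed

text \<open>Each \<open>u \<mapsto> D u h\<close> is holomorphic and bounded by a multiple of \<open>norm h\<close>. Its quadratic
  estimate therefore has an error proportional to \<open>norm h\<close>, which is what turns
  differentiability for every fixed \<open>h\<close> into differentiability in the operator norm.\<close>

lemma derivative_holomorphic:
  fixes f :: "'a::complex_normed_vector \<Rightarrow> 'b::complex_banach"
  assumes D: "\<And>u. u \<in> ball v (3 * R) \<Longrightarrow> (f has_derivative cblinfun_apply (D u)) (at u)"
    and M: "\<And>u. u \<in> ball v (3 * R) \<Longrightarrow> norm (f u) \<le> M" and R: "R > 0"
  obtains T :: "'a \<Rightarrow>\<^sub>C\<^sub>L ('a \<Rightarrow>\<^sub>C\<^sub>L 'b)" where "(D has_derivative cblinfun_apply T) (at v)"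
proof -
  have sub: "ball u (2 * R) \<subseteq> ball v (3 * R)" if "u \<in> ball v R" for u
  proof
    fix x assume "x \<in> ball u (2 * R)"
    then show "x \<in> ball v (3 * R)" using that dist_triangle[of v x u] by simp
  qed
  define N where "N = 10 * M / (2 * R)"
  have DN: "norm (D u) \<le> N" if u: "u \<in> ball v R" for u
    unfolding N_def
  proof (rule cauchy_estimate)
    show "holomorphic_map_on (ball u (2 * R)) f"
      using D sub[OF u] unfolding holomorphic_map_on_def by blast
    show "(f has_derivative cblinfun_apply (D u)) (at u)"
      using sub[OF u] R by (intro D) (metis centre_in_ball mult_pos_pos subsetD zero_less_numeral)
  qed (use M sub[OF u] R in auto)
  then have N0: "N \<ge> 0" using R norm_ge_zero[of "D v"] by (meson centre_in_ball order_trans)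
  have ex: "\<exists>S :: 'a \<Rightarrow>\<^sub>C\<^sub>L 'b. ((\<lambda>u. cblinfun_apply (D u) h) has_derivative cblinfun_apply S) (at u)"
    if "u \<in> ball v R" for u h
    using directional_derivative_holomorphic[of u R f D M h] D M sub[OF that] R by blast
  then have holo: "holomorphic_map_on (ball v R) (\<lambda>u. cblinfun_apply (D u) h)" for h
    unfolding holomorphic_map_on_def by blast
  have bound: "norm (cblinfun_apply (D u) h) \<le> N * norm h" if "u \<in> ball v R" for u h
    using norm_cblinfun_apply[of "D u" h] DN[OF that] by (meson mult_right_mono norm_ge_zero order_trans)
  obtain S :: "'a \<Rightarrow> 'a \<Rightarrow>\<^sub>C\<^sub>L 'b"
    where S: "\<And>h. ((\<lambda>u. cblinfun_apply (D u) h) has_derivative cblinfun_apply (S h)) (at v)"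
    using ex[of v] R by (metis centre_in_ball)
  note simps = linear_simps[OF bounded_linear_cblinfun_apply] plus_cblinfun.rep_eq
    cblinfun_apply_scaleR scaleC_cblinfun.rep_eq cblinfun_apply_scaleC
  \<comment> \<open>Linearity in the direction \<open>h\<close> passes from \<open>D u\<close> to the derivative of \<open>D u h\<close> in \<open>u\<close>.\<close>
  have add: "S (h + h') = S h + S h'" for h h'
  proof (rule has_derivative_cblinfun_unique[OF S])
    show "((\<lambda>u. cblinfun_apply (D u) (h + h')) has_derivative cblinfun_apply (S h + S h')) (at v)"
      using has_derivative_add[OF S[of h] S[of h']] by (simp add: simps plus_cblinfun.rep_eq[abs_def])
  qed
  have scaleC: "S (c *\<^sub>C h) = c *\<^sub>C S h" for c h
  proof (rule has_derivative_cblinfun_unique[OF S])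
    show "((\<lambda>u. cblinfun_apply (D u) (c *\<^sub>C h)) has_derivative cblinfun_apply (c *\<^sub>C S h)) (at v)"
      using bounded_linear.has_derivative[OF bounded_linear_scaleC S[of h], of c]
      by (simp add: simps scaleC_cblinfun.rep_eq[abs_def])
  qed
  have Sbound: "norm (S h) \<le> 10 * N / R * norm h" for h
    using cauchy_estimate[OF holo R bound S, of h] by simp
  have "bounded_bilinear (\<lambda>k h. cblinfun_apply (S h) k)"
  proof (rule bounded_bilinear.intro)
    show "\<exists>K. \<forall>k h. norm (cblinfun_apply (S h) k) \<le> norm k * norm h * K"
    proof (intro exI allI)
      fix k h
      have "norm (cblinfun_apply (S h) k) \<le> norm (S h) * norm k" by (rule norm_cblinfun_apply)
      also have "\<dots> \<le> 10 * N / R * norm h * norm k" by (intro mult_right_mono Sbound) simp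
      finally show "norm (cblinfun_apply (S h) k) \<le> norm k * norm h * (10 * N / R)"
        by (simp add: mult_ac)
    qed
  qed (simp_all add: add scaleR_scaleC scaleC simps)
  then obtain T :: "'a \<Rightarrow>\<^sub>C\<^sub>L ('a \<Rightarrow>\<^sub>C\<^sub>L 'b)"
    where T: "\<And>k h. cblinfun_apply (cblinfun_apply T k) h = cblinfun_apply (S h) k"
    by (rule cblinfun_of_bilinear) (auto simp: scaleC simps)
  have "(D has_derivative cblinfun_apply T) (at v)"
  proof (rule has_derivative_quadratic[OF bounded_linear_cblinfun_apply])
    show "R / 2 > 0" using R by simp
    fix k :: 'a assume k: "norm k < R / 2"
    show "norm (D (v + k) - D v - cblinfun_apply T k) \<le> 8 * N / R\<^sup>2 * (norm k)\<^sup>2"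
    proof (rule norm_cblinfun_bound)
      fix h
      show "norm (cblinfun_apply (D (v + k) - D v - cblinfun_apply T k) h)
          \<le> 8 * N / R\<^sup>2 * (norm k)\<^sup>2 * norm h"
        using holomorphic_quadratic_estimate[OF holo bound S k, of h]
        by (simp add: cblinfun_apply_diff T mult_ac)
    qed (use N0 in simp)
  qed
  then show ?thesis by (rule that)
qed

lemma differential_eqI:
  assumes "u \<in> ball 0 1" "(f has_derivative cblinfun_apply T) (at u)"
  shows "differential f u = T"
proof -
  have "(THE T. (f has_derivative cblinfun_apply T) (at u)) = T"
    by (rule the_equality, rule assms(2), erule has_derivative_cblinfun_unique[OF _ assms(2)])
  then show ?thesis using assms(1) by (simp only: differential_def if_True)
qed

lemma has_derivative_differential:
  assumes "holomorphic_on_ball f" "u \<in> ball 0 1"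
  shows "(f has_derivative cblinfun_apply (differential f u)) (at u)"
  using assms differential_eqI unfolding holomorphic_on_ball_def by metis

lemma differential_outside: "u \<notin> ball 0 1 \<Longrightarrow> differential f u = 0"
  by (simp only: differential_def if_False)

lemma holomorphic_on_ball_imp_map_on:
  "holomorphic_on_ball f \<Longrightarrow> S \<subseteq> ball 0 1 \<Longrightarrow> holomorphic_map_on S f"
  by (auto simp: holomorphic_map_on_def holomorphic_on_ball_def)

lemma ball_subset_unit_ball: "ball v (1 - norm v) \<subseteq> ball (0::'a::real_normed_vector) 1"
proof
  fix x assume "x \<in> ball v (1 - norm v)"
  then show "x \<in> ball 0 1" using norm_triangle_sub[of x v] by (simp add: dist_norm norm_minus_commute)
qed

lemma holomorphic_on_ball_differential:
  fixes f :: "'a::complex_normed_vector \<Rightarrow> 'b::complex_banach"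
  assumes f: "holomorphic_on_ball f" and bdd: "bounded (f ` ball 0 1)"
  shows "holomorphic_on_ball (differential f)"
  unfolding holomorphic_on_ball_def
proof
  fix v :: 'a assume v: "v \<in> ball 0 1"
  obtain M where M: "\<And>x. x \<in> ball 0 1 \<Longrightarrow> norm (f x) \<le> M"
    using bdd unfolding bounded_iff by blast
  define R where "R = (1 - norm v) / 3"
  have R: "R > 0" "3 * R = 1 - norm v" using v by (auto simp: R_def)
  have sub: "ball v (3 * R) \<subseteq> ball 0 1" unfolding R(2) by (rule ball_subset_unit_ball)
  show "\<exists>T. (differential f has_derivative cblinfun_apply T) (at v)"
    by (rule derivative_holomorphic[of v R f "differential f" M])
       (use sub has_derivative_differential[OF f] M R in auto)
qed

lemma holomorphic_on_ball_continuous: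
  "holomorphic_on_ball f \<Longrightarrow> continuous_on (ball 0 1) f"
  using has_derivative_differential has_derivative_continuous
  by (metis continuous_at_imp_continuous_on)

section \<open>Symmetry of the second differential\<close>

text \<open>Along \<open>s \<mapsto> v + s h\<close> the increment \<open>f (_ + t k) - f _\<close> has derivative
  \<open>(D (_ + t k) - D _) h\<close>, which is \<open>t T k h\<close> up to the errors of two first-order expansions
  of \<open>D\<close> at \<open>v\<close>. Integrating over \<open>[0, t]\<close> by the mean value inequality
  costs another factor \<open>t\<close>.\<close>

lemma second_difference_estimate:
  fixes f :: "'a::complex_normed_vector \<Rightarrow> 'b::complex_normed_vector"
  assumes D: "\<And>u. u \<in> ball v R \<Longrightarrow> (f has_derivative cblinfun_apply (D u)) (at u)"
    and Q: "\<And>k. norm k < R \<Longrightarrow> norm (D (v + k) - D v - cblinfun_apply T k) \<le> C * (norm k)\<^sup>2"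
    and t: "t > 0" "t * (norm h + norm k) < R" and C: "C \<ge> 0"
  shows "norm (f (v + t *\<^sub>R h + t *\<^sub>R k) - f (v + t *\<^sub>R h) - f (v + t *\<^sub>R k) + f v
      - t\<^sup>2 *\<^sub>R cblinfun_apply (cblinfun_apply T k) h) \<le> 2 * C * (norm h + norm k) ^ 3 * t ^ 3"
proof -
  define a where "a = norm h + norm k"
  define w where "w = cblinfun_apply (cblinfun_apply T k) h"
  define \<psi> where "\<psi> s = f (v + s *\<^sub>R h + t *\<^sub>R k) - f (v + s *\<^sub>R h) - s *\<^sub>R (t *\<^sub>R w)" for s
  define \<psi>' where "\<psi>' s = cblinfun_apply (D (v + s *\<^sub>R h + t *\<^sub>R k)) h - cblinfun_apply (D (v + s *\<^sub>R h)) h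
    - t *\<^sub>R w" for s
  have small: "norm (s *\<^sub>R h + t *\<^sub>R k) \<le> t * a" "norm (s *\<^sub>R h) \<le> t * a" if "s \<in> {0..t}" for s
  proof -
    have "s * norm h \<le> t * norm h" using that by (intro mult_right_mono) auto
    then show "norm (s *\<^sub>R h) \<le> t * a" using that t by (simp add: a_def algebra_simps add_increasing2)
    show "norm (s *\<^sub>R h + t *\<^sub>R k) \<le> t * a"
      using norm_triangle_ineq[of "s *\<^sub>R h" "t *\<^sub>R k"] \<open>s * norm h \<le> t * norm h\<close> that t
      by (simp add: a_def algebra_simps)
  qed
  have tR: "t * a < R" using t by (simp add: a_def)
  note simps = linear_simps[OF bounded_linear_cblinfun_apply] plus_cblinfun.rep_eq
    cblinfun_apply_scaleR cblinfun_apply_diff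
  have path: "((\<lambda>s. f (p + s *\<^sub>R h)) has_derivative (\<lambda>x. x *\<^sub>R cblinfun_apply (D (p + s *\<^sub>R h)) h)) (at s)"
    if "p + s *\<^sub>R h \<in> ball v R" for p s
  proof -
    have "((\<lambda>s. p + s *\<^sub>R h) has_derivative (\<lambda>x. x *\<^sub>R h)) (at s)"
      by (auto intro!: derivative_eq_intros)
    from has_derivative_compose[OF this D[OF that]] show ?thesis by (simp add: simps)
  qed
  have "norm (\<psi> t - \<psi> 0) \<le> (2 * C * a ^ 3 * t ^ 2) * norm (t - 0)"
  proof (rule differentiable_bound[where S = "{0..t}" and f' = "\<lambda>s x. x *\<^sub>R \<psi>' s"])
    fix s assume s: "s \<in> {0..t}"
    have "v + (s *\<^sub>R h + t *\<^sub>R k) \<in> ball v R" "v + s *\<^sub>R h \<in> ball v R"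
      unfolding mem_ball_shift using small[OF s] tR by linarith+
    then have "v + t *\<^sub>R k + s *\<^sub>R h \<in> ball v R" "v + s *\<^sub>R h \<in> ball v R"
      by (simp_all only: add.assoc add.commute[of "t *\<^sub>R k"])
    from path[OF this(1)] path[OF this(2)]
    have "(\<psi> has_derivative (\<lambda>x. x *\<^sub>R \<psi>' s)) (at s)"
      unfolding \<psi>_def \<psi>'_def
      by (auto intro!: derivative_eq_intros simp: algebra_simps)
    then show "(\<psi> has_derivative (\<lambda>x. x *\<^sub>R \<psi>' s)) (at s within {0..t})"
      by (rule has_derivative_at_withinI)
    let ?r = "\<lambda>x. D (v + x) - D v - cblinfun_apply T x"
    have r: "norm (?r x) \<le> C * (t * a)\<^sup>2" if "norm x \<le> t * a" for x
    proof -
      have "norm (?r x) \<le> C * (norm x)\<^sup>2" using that tR by (intro Q) simp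
      also have "\<dots> \<le> C * (t * a)\<^sup>2" using that C by (intro mult_left_mono power_mono) auto
      finally show ?thesis .
    qed
    have "\<psi>' s = cblinfun_apply (?r (s *\<^sub>R h + t *\<^sub>R k) - ?r (s *\<^sub>R h)) h"
      by (simp add: \<psi>'_def w_def simps add.assoc)
    also have "norm \<dots> \<le> norm (?r (s *\<^sub>R h + t *\<^sub>R k) - ?r (s *\<^sub>R h)) * norm h"
      by (rule norm_cblinfun_apply)
    also have "\<dots> \<le> (C * (t * a)\<^sup>2 + C * (t * a)\<^sup>2) * a"
    proof (rule mult_mono)
      show "norm (?r (s *\<^sub>R h + t *\<^sub>R k) - ?r (s *\<^sub>R h)) \<le> C * (t * a)\<^sup>2 + C * (t * a)\<^sup>2"
        using r[OF small(1)[OF s]] r[OF small(2)[OF s]] norm_triangle_ineq4 by (meson add_mono order_trans)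
    qed (use C in \<open>auto simp: a_def\<close>)
    also have "\<dots> = 2 * C * a ^ 3 * t ^ 2" by (simp add: power2_eq_square power3_eq_cube)
    finally have "norm (\<psi>' s) \<le> 2 * C * a ^ 3 * t ^ 2" .
    then have "norm (x *\<^sub>R \<psi>' s) \<le> 2 * C * a ^ 3 * t ^ 2 * norm x" for x
      by (simp add: mult.commute[of "\<bar>x\<bar>"] mult_right_mono)
    then show "onorm (\<lambda>x. x *\<^sub>R \<psi>' s) \<le> 2 * C * a ^ 3 * t ^ 2" by (rule onorm_le)
  qed (use t in auto)
  also have "(2 * C * a ^ 3 * t ^ 2) * norm (t - 0) = 2 * C * a ^ 3 * t ^ 3"
    using t by (simp add: power2_eq_square power3_eq_cube)
  also have "\<psi> t - \<psi> 0 = f (v + t *\<^sub>R h + t *\<^sub>R k) - f (v + t *\<^sub>R h) - f (v + t *\<^sub>R k) + f v - t\<^sup>2 *\<^sub>R w"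
    by (simp add: \<psi>_def power2_eq_square)
  finally show ?thesis by (simp add: a_def w_def)
qed

text \<open>The second difference does not change when \<open>h\<close> and \<open>k\<close> are exchanged, so the two values
  of \<open>T\<close> differ by \<open>O(t)\<close> after division by \<open>t\<^sup>2\<close>.\<close>

lemma second_derivative_symmetric:
  fixes f :: "'a::complex_normed_vector \<Rightarrow> 'b::complex_normed_vector"
  assumes D: "\<And>u. u \<in> ball v R \<Longrightarrow> (f has_derivative cblinfun_apply (D u)) (at u)"
    and Q: "\<And>k. norm k < R \<Longrightarrow> norm (D (v + k) - D v - cblinfun_apply T k) \<le> C * (norm k)\<^sup>2"
    and R: "R > 0" and C: "C \<ge> 0"
  shows "cblinfun_apply (cblinfun_apply T k) h = cblinfun_apply (cblinfun_apply T h) k"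
proof -
  define a where "a = norm h + norm k"
  let ?d = "cblinfun_apply (cblinfun_apply T h) k - cblinfun_apply (cblinfun_apply T k) h"
  have le: "norm ?d \<le> 4 * C * a ^ 3 * t" if t: "t > 0" "t * a < R" for t
  proof -
    let ?S = "f (v + t *\<^sub>R h + t *\<^sub>R k) - f (v + t *\<^sub>R h) - f (v + t *\<^sub>R k) + f v"
    have 1: "norm (?S - t\<^sup>2 *\<^sub>R cblinfun_apply (cblinfun_apply T k) h) \<le> 2 * C * a ^ 3 * t ^ 3"
      using second_difference_estimate[OF D Q t(1) _ C, where h = h and k = k] t by (simp add: a_def)
    have "f (v + t *\<^sub>R k + t *\<^sub>R h) - f (v + t *\<^sub>R k) - f (v + t *\<^sub>R h) + f v = ?S"
      by (simp add: algebra_simps)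
    moreover have "norm (f (v + t *\<^sub>R k + t *\<^sub>R h) - f (v + t *\<^sub>R k) - f (v + t *\<^sub>R h) + f v
        - t\<^sup>2 *\<^sub>R cblinfun_apply (cblinfun_apply T h) k) \<le> 2 * C * (norm k + norm h) ^ 3 * t ^ 3"
      using t by (intro second_difference_estimate[OF D Q t(1) _ C]) (simp_all add: a_def add.commute)
    ultimately have 2: "norm (?S - t\<^sup>2 *\<^sub>R cblinfun_apply (cblinfun_apply T h) k) \<le> 2 * C * a ^ 3 * t ^ 3"
      by (simp only: a_def add.commute[of "norm k"])
    have "t\<^sup>2 * norm ?d = norm (t\<^sup>2 *\<^sub>R ?d)" by simp
    also have "t\<^sup>2 *\<^sub>R ?d = (?S - t\<^sup>2 *\<^sub>R cblinfun_apply (cblinfun_apply T k) h)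
        - (?S - t\<^sup>2 *\<^sub>R cblinfun_apply (cblinfun_apply T h) k)"
      by (simp add: scaleR_diff_right)
    also have "norm \<dots> \<le> 2 * C * a ^ 3 * t ^ 3 + 2 * C * a ^ 3 * t ^ 3"
      by (rule order_trans[OF norm_triangle_ineq4 add_mono[OF 1 2]])
    also have "\<dots> = t\<^sup>2 * (4 * C * a ^ 3 * t)" by (simp add: power2_eq_square power3_eq_cube)
    finally show ?thesis using t(1) by simp
  qed
  have "((\<lambda>t. t * a) \<longlongrightarrow> 0 * a) (at_right 0)" by (intro tendsto_intros)
  then have "\<forall>\<^sub>F t in at_right 0. t * a < R" using R by (intro order_tendstoD(2)) auto
  moreover have "\<forall>\<^sub>F t :: real in at_right 0. t > 0" by (rule eventually_at_right_less)
  ultimately have "\<forall>\<^sub>F t in at_right 0. norm ?d \<le> 4 * C * a ^ 3 * t"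
    by eventually_elim (rule le)
  moreover have "((\<lambda>t. 4 * C * a ^ 3 * t) \<longlongrightarrow> 4 * C * a ^ 3 * 0) (at_right 0)"
    by (intro tendsto_intros)
  ultimately have "norm ?d \<le> 4 * C * a ^ 3 * 0"
    by (intro tendsto_lowerbound[where F = "at_right 0"]) auto
  then show ?thesis by simp
qed

lemma second_differential_symmetric:
  fixes f :: "'a::complex_normed_vector \<Rightarrow> 'b::complex_banach"
  assumes f: "holomorphic_on_ball f" and Df: "differential f \<in> Hinf" and v: "v \<in> ball 0 1"
  shows "cblinfun_apply (cblinfun_apply (differential (differential f) v) k) h =
    cblinfun_apply (cblinfun_apply (differential (differential f) v) h) k"
proof -
  obtain M where M: "\<And>x. x \<in> ball 0 1 \<Longrightarrow> norm (differential f x) \<le> M"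
    using Df unfolding Hinf_def bounded_iff by blast
  have M0: "M \<ge> 0" using M[OF v] norm_ge_zero order_trans by blast
  have D2: "holomorphic_on_ball (differential f)" using Df by (simp add: Hinf_def)
  define R where "R = 1 - norm v"
  have R: "R > 0" and sub: "ball v R \<subseteq> ball 0 1"
    using v ball_subset_unit_ball by (auto simp: R_def)
  show ?thesis
  proof (rule second_derivative_symmetric[where R = "R / 2" and f = f and D = "differential f" and v = v])
    show "(f has_derivative cblinfun_apply (differential f u)) (at u)" if "u \<in> ball v (R / 2)" for u
      using that sub R by (intro has_derivative_differential[OF f]) (auto simp: subset_iff)
    show "norm (differential f (v + k) - differential f v
        - cblinfun_apply (differential (differential f) v) k) \<le> 8 * M / R\<^sup>2 * (norm k)\<^sup>2"
      if "norm k < R / 2" for k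
      by (rule holomorphic_quadratic_estimate[OF holomorphic_on_ball_imp_map_on[OF D2 sub] _
            has_derivative_differential[OF D2 v] that]) (use M sub in auto)
  qed (use R M0 in auto)
qed

section \<open>Primitives of closed forms\<close>

text \<open>Differentiation under the integral sign integrates derivatives in the space of bounded
  real-linear maps, into which the complex-linear ones embed isometrically.\<close>

definition cblinfun_to_blinfun ::
    "'a::complex_normed_vector \<Rightarrow>\<^sub>C\<^sub>L 'b::complex_normed_vector \<Rightarrow> 'a \<Rightarrow>\<^sub>L 'b" where
  "cblinfun_to_blinfun T = Blinfun (cblinfun_apply T)"

lemma cblinfun_to_blinfun_apply: "blinfun_apply (cblinfun_to_blinfun T) = cblinfun_apply T"
  unfolding cblinfun_to_blinfun_def
  by (rule bounded_linear_Blinfun_apply) (rule bounded_linear_cblinfun_apply)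

lemma bounded_linear_cblinfun_to_blinfun: "bounded_linear cblinfun_to_blinfun"
proof (rule bounded_linear_intro[where K = 1])
  show "norm (cblinfun_to_blinfun T) \<le> norm T * 1" for T :: "'a \<Rightarrow>\<^sub>C\<^sub>L 'b"
    by (simp add: norm_blinfun.rep_eq norm_cblinfun.rep_eq cblinfun_to_blinfun_apply)
qed (auto intro!: blinfun_eqI simp: cblinfun_to_blinfun_apply plus_cblinfun.rep_eq cblinfun_apply_scaleR
      blinfun.bilinear_simps)

text \<open>The Poincare lemma on a star-shaped domain. The derivative of the integrand in direction
  \<open>h\<close> is \<open>g(tx)(h) + t dg(tx)(h)(x)\<close>; closedness turns this into
  \<open>g(tx)(h) + t dg(tx)(x)(h)\<close>, which is the derivative of \<open>t g(tx)(h)\<close> with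
  respect to \<open>t\<close> and integrates to \<open>g(x)(h)\<close>.\<close>

lemma closed_form_primitive:
  fixes g :: "'a::complex_banach \<Rightarrow> 'a \<Rightarrow>\<^sub>C\<^sub>L 'b::complex_banach"
  assumes g: "holomorphic_on_ball g" and bdd: "bounded (g ` ball 0 1)"
    and closed: "\<And>u h k. u \<in> ball 0 1 \<Longrightarrow>
      cblinfun_apply (cblinfun_apply (differential g u) h) k =
      cblinfun_apply (cblinfun_apply (differential g u) k) h"
    and x: "x \<in> ball 0 1"
  shows "((\<lambda>x. integral {0..1} (\<lambda>t. cblinfun_apply (g (t *\<^sub>R x)) x))
    has_derivative cblinfun_apply (g x)) (at x)"
proof -
  define B where "B = (cblinfun_to_blinfun :: 'a \<Rightarrow>\<^sub>C\<^sub>L 'b \<Rightarrow> 'a \<Rightarrow>\<^sub>L 'b)"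
  have B: "bounded_linear B" "\<And>T. blinfun_apply (B T) = cblinfun_apply T"
    by (simp_all add: B_def bounded_linear_cblinfun_to_blinfun cblinfun_to_blinfun_apply)
  define dg where "dg = differential g"
  have Dg: "(g has_derivative cblinfun_apply (dg u)) (at u)" if "u \<in> ball 0 1" for u
    unfolding dg_def using g that by (rule has_derivative_differential)
  have cont_g: "continuous_on (ball 0 1) g" using g by (rule holomorphic_on_ball_continuous)
  have cont_dg: "continuous_on (ball 0 1) dg"
    unfolding dg_def using holomorphic_on_ball_differential[OF g bdd] by (rule holomorphic_on_ball_continuous)
  have star: "t *\<^sub>R u \<in> ball 0 1" if "t \<in> {0..1}" "u \<in> ball 0 1" for t and u :: 'a
  proof -
    have "\<bar>t\<bar> * norm u \<le> 1 * norm u" using that by (intro mult_right_mono) auto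
    then show ?thesis using that by simp
  qed
  note apply_tendsto = bounded_bilinear.continuous_on[OF bounded_bilinear_cblinfun_apply]
  define F where "F u t = B (g (t *\<^sub>R u)) + t *\<^sub>R B (cblinfun_apply (dg (t *\<^sub>R u)) u)" for u t
  have "((\<lambda>u. integral (cbox 0 1) (\<lambda>t. cblinfun_apply (g (t *\<^sub>R u)) u))
      has_derivative integral (cbox 0 1) (F x)) (at x within ball 0 1)"
  proof (rule leibniz_rule[OF _ _ _ x])
    fix u t assume u: "u \<in> ball (0::'a) 1" and t: "t \<in> cbox (0::real) 1"
    have tu: "t *\<^sub>R u \<in> ball 0 1" using star[of t u] t u by simp
    have "((\<lambda>u. t *\<^sub>R u) has_derivative (\<lambda>h. t *\<^sub>R h)) (at u)"
      by (auto intro!: derivative_eq_intros)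
    from has_derivative_compose[OF this Dg[OF tu]]
    have "((\<lambda>u. g (t *\<^sub>R u)) has_derivative (\<lambda>h. cblinfun_apply (dg (t *\<^sub>R u)) (t *\<^sub>R h))) (at u)" .
    from bounded_bilinear.FDERIV[OF bounded_bilinear_cblinfun_apply this has_derivative_ident]
    have "((\<lambda>u. cblinfun_apply (g (t *\<^sub>R u)) u) has_derivative
        (\<lambda>h. cblinfun_apply (g (t *\<^sub>R u)) h + cblinfun_apply (cblinfun_apply (dg (t *\<^sub>R u)) (t *\<^sub>R h)) u)) (at u)" .
    \<comment> \<open>Closedness of the form moves \<open>h\<close> into the last argument.\<close>
    moreover have "cblinfun_apply (cblinfun_apply (dg (t *\<^sub>R u)) (t *\<^sub>R h)) u =
        t *\<^sub>R cblinfun_apply (cblinfun_apply (dg (t *\<^sub>R u)) u) h" for h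
      using closed[OF tu, of h u]
      by (simp add: dg_def linear_simps[OF bounded_linear_cblinfun_apply] cblinfun_apply_scaleR)
    moreover have "blinfun_apply (F u t) = (\<lambda>h. cblinfun_apply (g (t *\<^sub>R u)) h +
        t *\<^sub>R cblinfun_apply (cblinfun_apply (dg (t *\<^sub>R u)) u) h)"
      by (rule ext) (simp add: F_def B(2) blinfun.bilinear_simps)
    ultimately have "((\<lambda>u. cblinfun_apply (g (t *\<^sub>R u)) u) has_derivative blinfun_apply (F u t)) (at u)"
      by simp
    then show "((\<lambda>u. cblinfun_apply (g (t *\<^sub>R u)) u) has_derivative blinfun_apply (F u t)) (at u within ball 0 1)"
      by (rule has_derivative_at_withinI)
  next
    fix u :: 'a assume u: "u \<in> ball 0 1"
    have "continuous_on {0..1} (\<lambda>t. cblinfun_apply (g (t *\<^sub>R u)) u)"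
      by (intro apply_tendsto continuous_on_compose2[OF cont_g] continuous_intros)
         (use star u in auto)
    then show "(\<lambda>t. cblinfun_apply (g (t *\<^sub>R u)) u) integrable_on cbox 0 1"
      by (simp add: integrable_continuous_interval)
  next
    have "continuous_on (ball 0 1 \<times> cbox 0 1) (\<lambda>p. B (g (snd p *\<^sub>R fst p))
        + snd p *\<^sub>R B (cblinfun_apply (dg (snd p *\<^sub>R fst p)) (fst p)))"
      by (intro continuous_intros bounded_linear.continuous_on[OF B(1)] apply_tendsto
            continuous_on_compose2[OF cont_g] continuous_on_compose2[OF cont_dg])
         (use star in auto)
    then show "continuous_on (ball 0 1 \<times> cbox 0 1) (\<lambda>(u, t). F u t)"
      by (simp add: F_def split_beta)
  qed simp
  moreover have "integral (cbox 0 1) (F x) = B (g x)"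
  proof -
    have "(F x has_integral 1 *\<^sub>R B (g (1 *\<^sub>R x)) - 0 *\<^sub>R B (g (0 *\<^sub>R x))) {0..1}"
    proof (rule fundamental_theorem_of_calculus)
      fix t :: real assume t: "t \<in> {0..1}"
      have "((\<lambda>t. t *\<^sub>R x) has_derivative (\<lambda>s. s *\<^sub>R x)) (at t)"
        by (auto intro!: derivative_eq_intros)
      from has_derivative_compose[OF this Dg[OF star[OF t x]]]
      have "((\<lambda>t. B (g (t *\<^sub>R x))) has_derivative (\<lambda>s. B (cblinfun_apply (dg (t *\<^sub>R x)) (s *\<^sub>R x)))) (at t)"
        by (rule bounded_linear.has_derivative[OF B(1)])
      then have "((\<lambda>t. B (g (t *\<^sub>R x))) has_vector_derivative B (cblinfun_apply (dg (t *\<^sub>R x)) x)) (at t)"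
        by (simp add: has_vector_derivative_def linear_simps[OF bounded_linear_cblinfun_apply] linear_simps[OF B(1)])
      from has_vector_derivative_scaleR[OF DERIV_ident this]
      show "((\<lambda>t. t *\<^sub>R B (g (t *\<^sub>R x))) has_vector_derivative F x t) (at t within {0..1})"
        by (simp add: F_def add.commute has_vector_derivative_at_within)
    qed simp
    then show ?thesis by (simp add: integral_unique)
  qed
  ultimately show ?thesis
    by (simp add: B(2) at_within_open[OF x open_ball])
qed

section \<open>Symmetry tested on a Schauder basis\<close>

text \<open>In the zero space all coefficient sequences represent the vector \<open>0\<close>, contrary to
  uniqueness. This excludes the degenerate case in which the Lipschitz constant would be the
  supremum of an empty set.\<close>

lemma schauder_basis_nontrivial:
  fixes e :: "nat \<Rightarrow> 'a::complex_normed_vector"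
  assumes "schauder_basis e"
  obtains z :: 'a where "z \<noteq> 0"
proof (rule ccontr)
  assume "\<not> thesis"
  then have "e n = 0" for n using that by blast
  then have sums: "(\<lambda>n. a n *\<^sub>C e n) sums 0" for a by simp
  have "\<exists>!a. (\<lambda>n. a n *\<^sub>C e n) sums 0" using assms unfolding schauder_basis_def by (rule spec)
  then obtain a where "\<And>b. (\<lambda>n. b n *\<^sub>C e n) sums 0 \<Longrightarrow> b = a" by (elim ex1E) iprover
  then have "b = a" for b using sums by iprover
  from this[of "\<lambda>_. 0"] this[of "\<lambda>_. 1"] have "(0::complex) = 1" by (metis (full_types))
  then show False by simp
qed

lemma schauder_basis_ext:
  fixes e :: "nat \<Rightarrow> 'a::complex_normed_vector" and P Q :: "'a \<Rightarrow> 'b::complex_normed_vector"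
  assumes e: "schauder_basis e" and "bounded_linear P" "bounded_linear Q"
    and P: "\<And>c x. P (c *\<^sub>C x) = c *\<^sub>C P x" and Q: "\<And>c x. Q (c *\<^sub>C x) = c *\<^sub>C Q x"
    and eq: "\<And>n. P (e n) = Q (e n)"
  shows "P x = Q x"
proof -
  obtain a where a: "(\<lambda>n. a n *\<^sub>C e n) sums x" using e unfolding schauder_basis_def by blast
  have "(\<lambda>n. P (a n *\<^sub>C e n)) sums P x" "(\<lambda>n. Q (a n *\<^sub>C e n)) sums Q x"
    using bounded_linear.sums[OF assms(2) a] bounded_linear.sums[OF assms(3) a] by simp_all
  moreover have "P (a n *\<^sub>C e n) = Q (a n *\<^sub>C e n)" for n by (simp only: P Q eq)
  ultimately show ?thesis by (simp only: sums_unique2)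
qed

text \<open>Expand one argument at a time: first \<open>h\<close> against a basis vector, then \<open>k\<close> against an
  arbitrary \<open>h\<close>.\<close>

lemma bilinear_symmetric_on_basis:
  fixes e :: "nat \<Rightarrow> 'a::complex_normed_vector" and T :: "'a \<Rightarrow>\<^sub>C\<^sub>L ('a \<Rightarrow>\<^sub>C\<^sub>L 'b::complex_normed_vector)"
  assumes e: "schauder_basis e"
    and sym: "\<And>n k. cblinfun_apply (cblinfun_apply T (e n)) (e k) = cblinfun_apply (cblinfun_apply T (e k)) (e n)"
  shows "cblinfun_apply (cblinfun_apply T h) k = cblinfun_apply (cblinfun_apply T k) h"
proof -
  have left: "bounded_linear (\<lambda>h. cblinfun_apply (cblinfun_apply T h) k)" for k
    by (rule bounded_linear_compose[OF bounded_bilinear.bounded_linear_left[OF bounded_bilinear_cblinfun_apply]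
          bounded_linear_cblinfun_apply])
  note scale = cblinfun_apply_scaleC scaleC_cblinfun.rep_eq
  have "cblinfun_apply (cblinfun_apply T h) (e n) = cblinfun_apply (cblinfun_apply T (e n)) h" for h n
    by (rule schauder_basis_ext[OF e left bounded_linear_cblinfun_apply]) (simp_all add: scale sym)
  then show ?thesis
    by - (rule schauder_basis_ext[OF e bounded_linear_cblinfun_apply left], simp_all add: scale)
qed

text \<open>Evaluation at \<open>x\<close> is linear and continuous on operators, hence commutes with
  differentiation.\<close>

lemma differential_eval_comp:
  fixes g :: "'a::complex_normed_vector \<Rightarrow> 'a \<Rightarrow>\<^sub>C\<^sub>L 'b::complex_normed_vector"
  assumes g: "holomorphic_on_ball g" and u: "u \<in> ball 0 1"
  shows "cblinfun_apply (differential (eval_comp x g) u) y = cblinfun_apply (cblinfun_apply (differential g u) y) x"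
proof -
  let ?F = "\<lambda>y. cblinfun_apply (cblinfun_apply (differential g u) y) x"
  have ev: "bounded_linear (\<lambda>S. cblinfun_apply S x)"
    by (rule bounded_bilinear.bounded_linear_left[OF bounded_bilinear_cblinfun_apply])
  have "bounded_linear ?F"
    using bounded_linear_compose[OF ev bounded_linear_cblinfun_apply] .
  then have rep: "cblinfun_apply (CBlinfun ?F) = ?F"
    by (intro CBlinfun_inverse) (simp add: cblinfun_apply_scaleC scaleC_cblinfun.rep_eq)
  have "(eval_comp x g has_derivative ?F) (at u)"
    unfolding eval_comp_def
    using bounded_linear.has_derivative[OF ev has_derivative_differential[OF g u]] .
  then have "differential (eval_comp x g) u = CBlinfun ?F"
    using u by (intro differential_eqI) (simp_all add: rep)
  then show ?thesis by (simp add: rep)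
qed

lemma Hinf_s_iff_symmetric:
  fixes g :: "'a::complex_normed_vector \<Rightarrow> 'a \<Rightarrow>\<^sub>C\<^sub>L 'b::complex_normed_vector"
  assumes e: "schauder_basis e" and g: "g \<in> Hinf"
  shows "g \<in> Hinf_s e \<longleftrightarrow> (\<forall>u\<in>ball 0 1. \<forall>h k.
    cblinfun_apply (cblinfun_apply (differential g u) h) k =
    cblinfun_apply (cblinfun_apply (differential g u) k) h)"
proof -
  have hol: "holomorphic_on_ball g" using g by (simp add: Hinf_def)
  have "eval_comp (e k) (differential (eval_comp (e n) g)) u =
      (if u \<in> ball 0 1 then cblinfun_apply (cblinfun_apply (differential g u) (e k)) (e n) else 0)" for k n u
    using differential_eval_comp[OF hol, of u "e n" "e k"] differential_outside[of u "eval_comp (e n) g"]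
    by (auto simp: eval_comp_def zero_cblinfun.rep_eq)
  then have "g \<in> Hinf_s e \<longleftrightarrow> (\<forall>u\<in>ball 0 1. \<forall>n k.
      cblinfun_apply (cblinfun_apply (differential g u) (e k)) (e n) =
      cblinfun_apply (cblinfun_apply (differential g u) (e n)) (e k))"
    using g unfolding Hinf_s_def fun_eq_iff by auto
  then show ?thesis using bilinear_symmetric_on_basis[OF e] by metis
qed

section \<open>Lipschitz constants and differentials\<close>

lemma derivative_bound_of_lipschitz:
  fixes f :: "'a::real_normed_vector \<Rightarrow> 'b::real_normed_vector"
  assumes T: "(f has_derivative T) (at u)" and "open S" "u \<in> S"
    and lip: "\<And>y. y \<in> S \<Longrightarrow> norm (f y - f u) \<le> C * norm (y - u)"
  shows "norm (T h) \<le> C * norm h"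
proof (rule field_le_epsilon)
  fix \<epsilon> :: real assume \<epsilon>: "\<epsilon> > 0"
  have lin: "bounded_linear T" using T by (rule has_derivative_bounded_linear)
  define \<delta> where "\<delta> = \<epsilon> / (norm h + 1)"
  have nh: "norm h + 1 > 0" by (simp add: add_nonneg_pos)
  have \<delta>: "\<delta> > 0" "\<delta> * norm h \<le> \<epsilon>"
    using \<epsilon> nh by (simp_all add: \<delta>_def field_simps)
  obtain d where d: "d > 0" "\<And>y. norm (y - u) < d \<Longrightarrow> norm (f y - f u - T (y - u)) \<le> \<delta> * norm (y - u)"
    using T \<delta>(1) unfolding has_derivative_at_alt by blast
  obtain r where r: "r > 0" "ball u r \<subseteq> S" using assms(2,3) open_contains_ball by blast
  define t where "t = min d r / (norm h + 1) / 2"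
  have t: "t > 0" using d(1) r(1) nh by (simp add: t_def)
  have "t * norm h = min d r / 2 * (norm h / (norm h + 1))" by (simp add: t_def)
  also have "\<dots> \<le> min d r / 2 * 1" using d(1) r(1) nh by (intro mult_left_mono) simp_all
  finally have "t * norm h \<le> min d r / 2" by simp
  then have small: "t * norm h < d" "t * norm h < r" using d(1) r(1) by linarith+
  have "u + t *\<^sub>R h \<in> S"
    by (rule subsetD[OF r(2)]) (use small t in \<open>simp add: dist_norm\<close>)
  then have "norm (f (u + t *\<^sub>R h) - f u) \<le> C * (t * norm h)"
    using lip[of "u + t *\<^sub>R h"] t by simp
  moreover have "norm (f (u + t *\<^sub>R h) - f u - T (t *\<^sub>R h)) \<le> \<delta> * (t * norm h)"
    using d(2)[of "u + t *\<^sub>R h"] small t by simp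
  ultimately have "norm (T (t *\<^sub>R h)) \<le> C * (t * norm h) + \<delta> * (t * norm h)"
    using norm_triangle_ineq4[of "f (u + t *\<^sub>R h) - f u" "f (u + t *\<^sub>R h) - f u - T (t *\<^sub>R h)"] by simp
  also have "\<dots> = t * (C * norm h + \<delta> * norm h)" by (simp add: algebra_simps)
  finally have "norm (T h) \<le> C * norm h + \<delta> * norm h"
    using t by (simp add: linear_simps[OF lin])
  then show "norm (T h) \<le> C * norm h + \<epsilon>" using \<delta>(2) by simp
qed

lemma lipschitz_of_differential_bound:
  fixes f :: "'a::complex_normed_vector \<Rightarrow> 'b::complex_normed_vector"
  assumes f: "holomorphic_on_ball f" and K: "\<And>u. u \<in> ball 0 1 \<Longrightarrow> norm (differential f u) \<le> K"
    and "x \<in> ball 0 1" "y \<in> ball 0 1"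
  shows "norm (f x - f y) \<le> K * norm (x - y)"
proof (rule differentiable_bound[OF convex_ball])
  show "(f has_derivative cblinfun_apply (differential f u)) (at u within ball 0 1)"
    if "u \<in> ball 0 1" for u
    using has_derivative_differential[OF f that] by (rule has_derivative_at_withinI)
  show "onorm (cblinfun_apply (differential f u)) \<le> K" if "u \<in> ball 0 1" for u
    using K[OF that] by (simp add: norm_cblinfun.rep_eq)
qed (use assms in auto)

text \<open>Difference quotients bound the differential pointwise, and the mean value inequality on the
  convex ball gives the converse. A nonzero vector is required because on the zero space the set of difference quotients is
  empty and its supremum carries no information.\<close>

lemma HL0_norms:
  fixes f :: "'a::complex_normed_vector \<Rightarrow> 'b::complex_normed_vector" and z :: 'a
  assumes f: "f \<in> HL0" and z: "z \<noteq> 0"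
  shows "bounded (differential f ` ball 0 1)" "Hinf_norm (differential f) = lip_norm f"
proof -
  define Q where "Q = {norm (f x - f y) / norm (x - y) | x y. x \<in> ball 0 1 \<and> y \<in> ball 0 1 \<and> x \<noteq> y}"
  have L: "lip_norm f = Sup Q" by (simp add: lip_norm_def Q_def)
  have hol: "holomorphic_on_ball f" using f by (simp add: HL0_def Hinf_def)
  obtain C where "C-lipschitz_on (ball 0 1) f" using f by (auto simp: HL0_def)
  then have C: "norm (f x - f y) \<le> C * norm (x - y)" if "x \<in> ball 0 1" "y \<in> ball 0 1" for x y
    using lipschitz_onD[of C "ball 0 1" f x y] that by (simp add: dist_norm)
  have bdd: "bdd_above Q"
  proof (rule bdd_aboveI)
    show "q \<le> C" if "q \<in> Q" for q using that C by (auto simp: Q_def divide_le_eq)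
  qed
  define z1 where "z1 = z /\<^sub>R (2 * norm z)"
  have "z1 \<in> ball 0 1" "z1 \<noteq> 0" using z by (auto simp: z1_def)
  then have z1_in: "norm (f z1 - f 0) / norm (z1 - 0) \<in> Q"
    unfolding Q_def by (metis (mono_tags, lifting) centre_in_ball mem_Collect_eq zero_less_one)
  have ne: "Q \<noteq> {}" using z1_in by (rule ex_in_conv[THEN iffD1, OF exI])
  have "0 \<le> norm (f z1 - f 0) / norm (z1 - 0)" by simp
  also have "\<dots> \<le> lip_norm f" unfolding L using z1_in bdd by (rule cSup_upper)
  finally have L0: "lip_norm f \<ge> 0" .
  have lip: "norm (f x - f y) \<le> lip_norm f * norm (x - y)" if "x \<in> ball 0 1" "y \<in> ball 0 1" for x y
  proof (cases "x = y")
    case False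
    then have "norm (f x - f y) / norm (x - y) \<le> lip_norm f"
      unfolding L using that by (intro cSup_upper bdd) (auto simp: Q_def)
    then show ?thesis using False by (simp add: divide_le_eq)
  qed simp
  have le: "norm (differential f u) \<le> lip_norm f" if u: "u \<in> ball 0 1" for u
    by (rule norm_cblinfun_bound[OF L0 derivative_bound_of_lipschitz[OF has_derivative_differential[OF hol u]
            open_ball u lip[OF _ u]]])
  then show "bounded (differential f ` ball 0 1)"
    unfolding bounded_iff by blast
  have bdd': "bdd_above ((\<lambda>u. norm (differential f u)) ` ball 0 1)"
    using le by (rule bdd_aboveI2)
  show "Hinf_norm (differential f) = lip_norm f"
  proof (rule antisym)
    show "Hinf_norm (differential f) \<le> lip_norm f"
      unfolding Hinf_norm_def using le by (intro cSUP_least) auto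
    have "norm (differential f u) \<le> Hinf_norm (differential f)" if "u \<in> ball 0 1" for u
      unfolding Hinf_norm_def using that bdd' by (rule cSUP_upper)
    from lipschitz_of_differential_bound[OF hol this]
    show "lip_norm f \<le> Hinf_norm (differential f)"
      unfolding L by (intro cSup_least ne) (auto simp: Q_def divide_le_eq)
  qed
qed

section \<open>The isometric isomorphism\<close>

lemma differential_in_Hinf_s:
  fixes f :: "'a::complex_normed_vector \<Rightarrow> 'b::complex_banach"
  assumes e: "schauder_basis e" and f: "f \<in> HL0"
  shows "differential f \<in> Hinf_s e"
proof -
  obtain z :: 'a where z: "z \<noteq> 0" using schauder_basis_nontrivial[OF e] .
  have hol: "holomorphic_on_ball f" "bounded (f ` ball 0 1)" using f by (auto simp: HL0_def Hinf_def)
  have "differential f \<in> Hinf"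
    using holomorphic_on_ball_differential[OF hol] HL0_norms(1)[OF f z] differential_outside
    by (auto simp: Hinf_def ball_map_def simp del: mem_ball)
  then show ?thesis
    using Hinf_s_iff_symmetric[OF e] second_differential_symmetric[OF hol(1)] by blast
qed

text \<open>The primitive of \<open>g\<close>, cut off outside the ball, is bounded and Lipschitz with any bound of
  \<open>g\<close> as its constant, because \<open>g\<close> is its differential.\<close>

lemma Hinf_s_imp_differential:
  fixes g :: "'a::complex_banach \<Rightarrow> 'a \<Rightarrow>\<^sub>C\<^sub>L 'b::complex_banach"
  assumes e: "schauder_basis e" and g: "g \<in> Hinf_s e"
  obtains f where "f \<in> HL0" "differential f = g"
proof
  have Hinf: "g \<in> Hinf" using g by (simp add: Hinf_s_def)
  then have hol: "holomorphic_on_ball g" and bdd: "bounded (g ` ball 0 1)"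
    and out: "\<And>u. u \<notin> ball 0 1 \<Longrightarrow> g u = 0"
    by (auto simp: Hinf_def ball_map_def simp del: mem_ball)
  obtain K where K: "\<And>u. u \<in> ball 0 1 \<Longrightarrow> norm (g u) \<le> K"
    using bdd unfolding bounded_iff by blast
  have K0: "K \<ge> 0" using K[of 0] norm_ge_zero[of "g 0"] by (simp del: norm_ge_zero)
  define p where "p x = integral {0..1} (\<lambda>t. cblinfun_apply (g (t *\<^sub>R x)) x)" for x
  define f where "f x = (if x \<in> ball 0 1 then p x else 0)" for x
  have D: "(f has_derivative cblinfun_apply (g u)) (at u)" if u: "u \<in> ball 0 1" for u
  proof (rule has_derivative_transform_within_open[OF _ open_ball u])
    show "(p has_derivative cblinfun_apply (g u)) (at u)"
      unfolding p_def using Hinf_s_iff_symmetric[OF e Hinf] g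
      by (intro closed_form_primitive[OF hol bdd _ u]) blast
  qed (simp add: f_def)
  then have holf: "holomorphic_on_ball f" unfolding holomorphic_on_ball_def by blast
  show df: "differential f = g"
  proof
    show "differential f u = g u" for u
      using differential_eqI[OF _ D] differential_outside out by (cases "u \<in> ball 0 1") auto
  qed
  have f0: "f 0 = 0"
    by (simp add: f_def p_def linear_simps[OF bounded_linear_cblinfun_apply])
  have lip: "norm (f x - f y) \<le> K * norm (x - y)" if "x \<in> ball 0 1" "y \<in> ball 0 1" for x y
    using lipschitz_of_differential_bound[OF holf _ that] K by (simp add: df)
  have "norm (f x) \<le> K" if "x \<in> ball 0 1" for x
    using lip[OF that, of 0] f0 that K0 mult_left_le[of "norm x" K] by simp
  then have "bounded (f ` ball 0 1)" unfolding bounded_iff by blast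
  moreover have "K-lipschitz_on (ball 0 1) f"
    using lip K0 by (auto simp: lipschitz_on_def dist_norm)
  ultimately show "f \<in> HL0"
    using holf f0 by (auto simp: HL0_def Hinf_def ball_map_def f_def)
qed

theorem corollary3p10:
  fixes e :: "nat \<Rightarrow> 'a::complex_banach"
  assumes "schauder_basis e"
  shows "isometric_isomorphism
    (HL0 :: ('a \<Rightarrow> 'b::complex_banach) set) lip_norm
    (Hinf_s e :: ('a \<Rightarrow> 'a \<Rightarrow>\<^sub>C\<^sub>L 'b) set) Hinf_norm
    differential"
  unfolding isometric_isomorphism_def
proof (intro conjI ballI allI)
  obtain z :: 'a where z: "z \<noteq> 0" using schauder_basis_nontrivial[OF assms] .
  show "differential ` (HL0 :: ('a \<Rightarrow> 'b) set) = Hinf_s e"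
  proof (intro equalityI subsetI)
    fix g :: "'a \<Rightarrow> 'a \<Rightarrow>\<^sub>C\<^sub>L 'b"
    assume "g \<in> Hinf_s e"
    then show "g \<in> differential ` HL0" by (rule Hinf_s_imp_differential[OF assms]) blast
  qed (use differential_in_Hinf_s[OF assms] in auto)
  show "Hinf_norm (differential f) = lip_norm f" if "f \<in> HL0" for f :: "'a \<Rightarrow> 'b"
    using HL0_norms(2)[OF that z] .
  have D: "(f has_derivative cblinfun_apply (differential f u)) (at u)"
    if "f \<in> HL0" "u \<in> ball 0 1" for f :: "'a \<Rightarrow> 'b" and u
    using that by (intro has_derivative_differential) (auto simp: HL0_def Hinf_def)
  show "differential (\<lambda>u. f u + g u) = (\<lambda>u. differential f u + differential g u)"
    if "f \<in> HL0" "g \<in> HL0" for f g :: "'a \<Rightarrow> 'b"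
  proof
    fix u
    show "differential (\<lambda>u. f u + g u) u = differential f u + differential g u"
    proof (cases "u \<in> ball 0 1")
      case True
      have "((\<lambda>u. f u + g u) has_derivative cblinfun_apply (differential f u + differential g u)) (at u)"
        using has_derivative_add[OF D[OF that(1) True] D[OF that(2) True]]
        by (simp add: plus_cblinfun.rep_eq[abs_def])
      then show ?thesis by (rule differential_eqI[OF True])
    qed (simp add: differential_outside del: mem_ball)
  qed
  show "differential (\<lambda>u. c *\<^sub>C f u) = (\<lambda>u. c *\<^sub>C differential f u)"
    if "f \<in> HL0" for c and f :: "'a \<Rightarrow> 'b"
  proof
    fix u
    show "differential (\<lambda>u. c *\<^sub>C f u) u = c *\<^sub>C differential f u"
    proof (cases "u \<in> ball 0 1")
      case True
      have "((\<lambda>u. c *\<^sub>C f u) has_derivative cblinfun_apply (c *\<^sub>C differential f u)) (at u)"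
        using bounded_linear.has_derivative[OF bounded_linear_scaleC D[OF that True], of c]
        by (simp add: scaleC_cblinfun.rep_eq[abs_def])
      then show ?thesis by (rule differential_eqI[OF True])
    qed (simp add: differential_outside del: mem_ball)
  qed
qed

end
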